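(* Let $m\in\mathbb{N}^*$, $a\in\mathbb{R}$, $I_f\in\mathbb{I}_{a+}$, let $\Omega$ be a nonempty open subset of $\mathbb{R}^m$, let $f:\Omega\times I_f\to\mathbb{R}^m$ be a Carathéodory function, let $q_a\in\Omega$ and $\alpha=(\alpha_1,\dots,\alpha_m)\in(0,1]^m$. Assume that for any compact $K\subset\Omega$ and any $[c,d]\subset I_f$ there exists $M\ge0$ such that $|f(x,t)|_m\le M$ for any $x\in K$ and for almost every $t\in[c,d]$. Then a couple $(q,I)$ is a local solution of the Cauchy problem $${}_{\mathrm c}\mathrm{D}^\alpha_{a+}[q](t)=f(q(t),t),\qquad q(a)=q_a$$ if and only if $I\in\mathbb{I}_{a+}$ with $I\subset I_f$, $q\in\mathrm{C}(I,\Omega)$ and $$q(t)=q_a+\mathrm{I}^\alpha_{a+}[f(q,\cdot)](t)=q_a+\int_a^t\Big[\tfrac{1}{\Gamma(\alpha)}(t-\tau)^{\alpha-1}\Big]\otimes f(q(\tau),\tau)\,d\tau$$ for every $t\in I$.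
   Context: $\mathbb{N}^*$ is the set of positive integers, $|\cdot|_m$ is the Euclidean norm of $\mathbb{R}^m$. For $a\in\mathbb{R}$, $\mathbb{I}_{a+}$ denotes the set of intervals $I\subset\mathbb{R}$ with $\{a\}\subsetneq I\subset[a,+\infty)$ (not necessarily compact). $\mathrm{L}^1_{\mathrm{loc}}(I)$ (resp. $\mathrm{AC}_{\mathrm{loc}}(I)$) is the set of functions on $I$ that are integrable (resp. absolutely continuous) on every compact subinterval of $I$; $\mathrm{C}(I,\Omega)$ is the set of continuous functions from $I$ to $\Omega$. The notation $f(q,\cdot)$ stands for $t\mapsto f(q(t),t)$. Left fractional operators. Let $I\in\mathbb{I}_{a+}$ and $q\in \mathrm{L}^1_{\mathrm{loc}}(I,\mathbb{R})$. For a real $\alpha>0$, $\mathrm{I}^\alpha_{a+}[q](t):=\int_a^t\frac{1}{\Gamma(\alpha)}(t-\tau)^{\alpha-1}q(\tau)\,d\tau$ (defined for a.e. $t\in I$), and $\mathrm{I}^0_{a+}[q]:=q$; if $\mathrm{I}^\alpha_{a+}[q]$ is a.e. equal to a continuous function, it is identified with it. For $0\le\alpha\le1$, $\mathrm{AC}^\alpha_{a+}(I,\mathbb{R})$ is the set of $q\in \mathrm{L}^1_{\mathrm{loc}}(I,\mathbb{R})$ with $\mathrm{I}^{1-\alpha}_{a+}[q]\in\mathrm{AC}_{\mathrm{loc}}(I,\mathbb{R})$, and then $\mathrm{D}^\alpha_{a+}[q]:=\frac{d}{dt}\mathrm{I}^{1-\alpha}_{a+}[q]$ a.e. on $I$.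 ${}_{\mathrm c}\mathrm{AC}^\alpha_{a+}(I,\mathbb{R})$ is the set of $q\in\mathrm{C}(I,\mathbb{R})$ with $q-q(a)\in\mathrm{AC}^\alpha_{a+}(I,\mathbb{R})$, and then ${}_{\mathrm c}\mathrm{D}^\alpha_{a+}[q]:=\mathrm{D}^\alpha_{a+}[q-q(a)]$. For vector functions $q=(q_i)$ and a multi-order $\alpha=(\alpha_i)$ everything is taken componentwise, the $i$-th component with order $\alpha_i$; ${}_{\mathrm c}\mathrm{AC}^\alpha_{a+}(I,\Omega)$ consists of those functions with values in $\Omega$. $\otimes$ is the componentwise (Hadamard) product and $\big[\frac{1}{\Gamma(\alpha)}(t-\tau)^{\alpha-1}\big]$ is the vector with components $\frac{1}{\Gamma(\alpha_i)}(t-\tau)^{\alpha_i-1}$. A local solution of the Cauchy problem is a couple $(q,I)$ with $I\in\mathbb{I}_{a+}$, $I\subset I_f$, $q\in{}_{\mathrm c}\mathrm{AC}^\alpha_{a+}(I,\Omega)$, $q(a)=q_a$ and ${}_{\mathrm c}\mathrm{D}^\alpha_{a+}[q](t)=f(q(t),t)$ for a.e. $t\in I$. *)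

theory Defs
  imports "HOL-Analysis.Analysis"
begin

text \<open>
  A function on an interval \<open>I\<close> is represented by a total function on \<open>real\<close>; every notion below
  depends only on its values on \<open>I\<close>. "Almost everywhere" and "measurable" refer to Lebesgue measure.
\<close>

definition intervals_from :: "real \<Rightarrow> real set set" where
  "intervals_from a = {I. is_interval I \<and> {a} \<subset> I \<and> I \<subseteq> {a..}}"

definition L1_loc :: "real set \<Rightarrow> (real \<Rightarrow> real) set" where
  "L1_loc I = {q. \<forall>c d. {c..d} \<subseteq> I \<longrightarrow> integrable (lebesgue_on {c..d}) q}"

text \<open>Absolute continuity of functions; the library constant of that name concerns measures.\<close>

definition abs_continuous_on :: "real \<Rightarrow> real \<Rightarrow> (real \<Rightarrow> real) \<Rightarrow> bool" where
  "abs_continuous_on c d g \<longleftrightarrow>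
    (\<forall>\<epsilon>>0. \<exists>\<delta>>0. \<forall>(n::nat) (u::nat \<Rightarrow> real) (v::nat \<Rightarrow> real).
      (\<forall>k<n. c \<le> u k \<and> u k \<le> v k \<and> v k \<le> d) \<and>
      (\<forall>j<n. \<forall>k<n. j \<noteq> k \<longrightarrow> {u j<..<v j} \<inter> {u k<..<v k} = {}) \<and>
      (\<Sum>k<n. v k - u k) < \<delta>
      \<longrightarrow> (\<Sum>k<n. \<bar>g (v k) - g (u k)\<bar>) < \<epsilon>)"

definition AC_loc :: "real set \<Rightarrow> (real \<Rightarrow> real) set" where
  "AC_loc I = {g. \<forall>c d. {c..d} \<subseteq> I \<longrightarrow> abs_continuous_on c d g}"

text \<open>
  The identification convention: a function that is almost everywhere on \<open>I\<close> equal to a continuous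
  function is replaced by that function (unique on \<open>I\<close> when \<open>I\<close> is a nondegenerate interval).
\<close>

definition continuous_version :: "real set \<Rightarrow> (real \<Rightarrow> real) \<Rightarrow> real \<Rightarrow> real" where
  "continuous_version I g =
    (if \<exists>h. continuous_on I h \<and> (AE t in lebesgue_on I. g t = h t)
     then SOME h. continuous_on I h \<and> (AE t in lebesgue_on I. g t = h t)
     else g)"

definition frac_kernel :: "real \<Rightarrow> real \<Rightarrow> real \<Rightarrow> real" where
  "frac_kernel \<alpha> t \<tau> = 1 / Gamma \<alpha> * (t - \<tau>) powr (\<alpha> - 1)"

definition left_frac_int_raw :: "real \<Rightarrow> real \<Rightarrow> (real \<Rightarrow> real) \<Rightarrow> real \<Rightarrow> real" where
  "left_frac_int_raw a \<alpha> q t =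
    (if \<alpha> = 0 then q t else (LINT \<tau>:{a..t}|lebesgue. frac_kernel \<alpha> t \<tau> * q \<tau>))"

definition left_frac_int :: "real \<Rightarrow> real set \<Rightarrow> real \<Rightarrow> (real \<Rightarrow> real) \<Rightarrow> real \<Rightarrow> real" where
  "left_frac_int a I \<alpha> q = continuous_version I (left_frac_int_raw a \<alpha> q)"

definition AC_frac :: "real \<Rightarrow> real set \<Rightarrow> real \<Rightarrow> (real \<Rightarrow> real) set" where
  "AC_frac a I \<alpha> = {q \<in> L1_loc I. left_frac_int a I (1 - \<alpha>) q \<in> AC_loc I}"

text \<open>
  The derivatives are only defined at almost every point, so they are given as relations:
  the derivative at \<open>t\<close> exists and has the value \<open>y\<close>. For members of the corresponding
  \<open>AC\<close> space existence almost everywhere is automatic.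
\<close>

definition has_left_frac_deriv ::
    "real \<Rightarrow> real set \<Rightarrow> real \<Rightarrow> (real \<Rightarrow> real) \<Rightarrow> real \<Rightarrow> real \<Rightarrow> bool" where
  "has_left_frac_deriv a I \<alpha> q t y \<longleftrightarrow>
    (left_frac_int a I (1 - \<alpha>) q has_real_derivative y) (at t within I)"

definition cAC_frac :: "real \<Rightarrow> real set \<Rightarrow> real \<Rightarrow> (real \<Rightarrow> real) set" where
  "cAC_frac a I \<alpha> = {q. continuous_on I q \<and> (\<lambda>t. q t - q a) \<in> AC_frac a I \<alpha>}"

definition has_left_caputo_deriv ::
    "real \<Rightarrow> real set \<Rightarrow> real \<Rightarrow> (real \<Rightarrow> real) \<Rightarrow> real \<Rightarrow> real \<Rightarrow> bool" where
  "has_left_caputo_deriv a I \<alpha> q t y \<longleftrightarrow> has_left_frac_deriv a I \<alpha> (\<lambda>s. q s - q a) t y"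

text \<open>
  Multi-order versions for vector functions. The Hadamard product is the library's componentwise
  multiplication of vectors.
\<close>

definition frac_kernel_vec :: "real ^ 'm \<Rightarrow> real \<Rightarrow> real \<Rightarrow> real ^ 'm" where
  "frac_kernel_vec \<alpha> t \<tau> = (\<chi> i. frac_kernel (\<alpha> $ i) t \<tau>)"

definition left_frac_int_vec ::
    "real \<Rightarrow> real set \<Rightarrow> real ^ 'm \<Rightarrow> (real \<Rightarrow> real ^ 'm) \<Rightarrow> real \<Rightarrow> real ^ 'm" where
  "left_frac_int_vec a I \<alpha> q t = (\<chi> i. left_frac_int a I (\<alpha> $ i) (\<lambda>s. q s $ i) t)"

definition cAC_frac_vec ::
    "real \<Rightarrow> real set \<Rightarrow> real ^ 'm \<Rightarrow> (real ^ 'm) set \<Rightarrow> (real \<Rightarrow> real ^ 'm) set" where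
  "cAC_frac_vec a I \<alpha> \<Omega> = {q. q ` I \<subseteq> \<Omega> \<and> (\<forall>i. (\<lambda>s. q s $ i) \<in> cAC_frac a I (\<alpha> $ i))}"

definition has_left_caputo_deriv_vec ::
    "real \<Rightarrow> real set \<Rightarrow> real ^ 'm \<Rightarrow> (real \<Rightarrow> real ^ 'm) \<Rightarrow> real \<Rightarrow> real ^ 'm \<Rightarrow> bool" where
  "has_left_caputo_deriv_vec a I \<alpha> q t y \<longleftrightarrow>
    (\<forall>i. has_left_caputo_deriv a I (\<alpha> $ i) (\<lambda>s. q s $ i) t (y $ i))"

definition caratheodory ::
    "(real ^ 'm) set \<Rightarrow> real set \<Rightarrow> (real ^ 'm \<Rightarrow> real \<Rightarrow> real ^ 'm) \<Rightarrow> bool" where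
  "caratheodory \<Omega> J f \<longleftrightarrow>
    (AE t in lebesgue_on J. continuous_on \<Omega> (\<lambda>x. f x t)) \<and>
    (\<forall>x\<in>\<Omega>. f x \<in> borel_measurable (lebesgue_on J))"

definition local_solution ::
    "real \<Rightarrow> real set \<Rightarrow> (real ^ 'm) set \<Rightarrow> (real ^ 'm \<Rightarrow> real \<Rightarrow> real ^ 'm) \<Rightarrow> real ^ 'm \<Rightarrow> real ^ 'm \<Rightarrow>
      (real \<Rightarrow> real ^ 'm) \<Rightarrow> real set \<Rightarrow> bool" where
  "local_solution a I\<^sub>f \<Omega> f q\<^sub>a \<alpha> q I \<longleftrightarrow>
    I \<in> intervals_from a \<and> I \<subseteq> I\<^sub>f \<and> q \<in> cAC_frac_vec a I \<alpha> \<Omega> \<and> q a = q\<^sub>a \<and>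
    (AE t in lebesgue_on I. has_left_caputo_deriv_vec a I \<alpha> q t (f (q t) t))"

end

theory Submission
  imports Defs
begin

text \<open>
  Fix a component and write $g(t) = f(q(t),t)$. The Caratheodory condition makes $g$ measurable and the bound on
  compact sets makes it locally essentially bounded, so on every $[a,b]\subseteq I$ it agrees almost everywhere with a
  bounded Borel function. For such functions the semigroup law $I^{1-\alpha} I^\alpha = I^\alpha I^{1-\alpha} = I^1$
  (Fubini and the Beta integral) makes $q - q(a) = I^\alpha[g]$ equivalent to $I^{1-\alpha}[q - q(a)] = I^1[g]$. The latter
  says that the primitive $I^1[g]$ is $I^{1-\alpha}[q - q(a)]$, and this is equivalent to local absolute continuity with
  derivative $g$ almost everywhere, by Lebesgue's differentiation theorem and the fundamental theorem of calculus
  for absolutely continuous functions. Fractional integrals of positive order are Hoelder continuous, so the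
  almost-everywhere identification is harmless.
\<close>

section \<open>Absolutely continuous functions\<close>

text \<open>Returning from I^{1-\<alpha>}[q - q(a)] = I^1[g] to q - q(a) = I^\<alpha>[g] requires
  injectivity of I^{1-\<alpha>} on continuous functions. Borel representatives are used because
  Fubini asks for joint measurability with respect to a product of Borel measures, whereas g is only
  Lebesgue measurable. The interval may be unbounded or lack its right end, so representatives and
  bounds live on [a,b] with b in I, and facts about I are glued from these. The null set in the
  bound on f depends on x, while x = q(t) runs through uncountably many values. Finally, 0 powr y =
  0 makes the kernel vanish at \<tau> = t, even for order 1; this concerns a single point, but
  pointwise inequalities must take it into account.\<close>

text \<open>Gauge arguments deliver intervals as tagged pairs, absolute continuity speaks of indexed
  sequences. Enumerating the pairs translates one into the other; disjoint interiors become disjoint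
  open intervals.\<close>

lemma abs_continuous_on_tagged_partial_division:
  fixes F :: "real \<Rightarrow> real"
  assumes "abs_continuous_on a b F" and "\<epsilon> > 0"
  obtains \<delta> where "\<delta> > 0"
    "\<And>p. p tagged_partial_division_of {a..b} \<Longrightarrow> (\<Sum>(x,K)\<in>p. measure lborel K) < \<delta>
      \<Longrightarrow> (\<Sum>(x,K)\<in>p. \<bar>F (Sup K) - F (Inf K)\<bar>) < \<epsilon>"
proof -
  obtain \<delta> where "\<delta> > 0" and \<delta>: "\<forall>(n::nat) (u::nat \<Rightarrow> real) (v::nat \<Rightarrow> real).
      (\<forall>k<n. a \<le> u k \<and> u k \<le> v k \<and> v k \<le> b) \<and>
      (\<forall>j<n. \<forall>k<n. j \<noteq> k \<longrightarrow> {u j<..<v j} \<inter> {u k<..<v k} = {}) \<and>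
      (\<Sum>k<n. v k - u k) < \<delta> \<longrightarrow> (\<Sum>k<n. \<bar>F (v k) - F (u k)\<bar>) < \<epsilon>"
    using assms(1)[unfolded abs_continuous_on_def, THEN spec, THEN mp, OF assms(2)] by (elim exE conjE) (rule that)
  have "(\<Sum>(x,K)\<in>p. \<bar>F (Sup K) - F (Inf K)\<bar>) < \<epsilon>"
    if p: "p tagged_partial_division_of {a..b}" and small: "(\<Sum>(x,K)\<in>p. measure lborel K) < \<delta>" for p
  proof -
    note pD = tagged_partial_division_ofD[OF p]
    obtain h where h: "bij_betw h {..<card p} p"
      using bij_betw_from_nat_into_finite[OF pD(1)] by blast
    define u where "u k = Inf (snd (h k))" for k
    define v where "v k = Sup (snd (h k))" for k
    have uv: "snd (h k) = {u k..v k} \<and> a \<le> u k \<and> u k \<le> v k \<and> v k \<le> b" if "k < card p" for k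
    proof -
      obtain x K where xK: "h k = (x,K)" by fastforce
      then have "(x,K) \<in> p" using h that by (metis bij_betwE lessThan_iff)
      then obtain c d where K: "K = {c..d}" "x \<in> K" "K \<subseteq> {a..b}"
        using pD(2,3,4) by (metis cbox_interval)
      then have "c \<le> d" by auto
      then show ?thesis using K xK by (simp add: u_def v_def)
    qed
    have disj: "{u j<..<v j} \<inter> {u k<..<v k} = {}" if "j < card p" "k < card p" "j \<noteq> k" for j k
    proof -
      have "h j \<noteq> h k" using that h by (auto simp: bij_betw_def inj_on_def)
      moreover have "h j \<in> p" "h k \<in> p" using that h by (auto simp: bij_betw_def)
      ultimately have "interior (snd (h j)) \<inter> interior (snd (h k)) = {}"
        by (metis pD(5) prod.collapse)
      then show ?thesis using uv that by simp
    qed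
    have reindex: "(\<Sum>(x,K)\<in>p. w K) = (\<Sum>k<card p. w (snd (h k)))" for w :: "real set \<Rightarrow> real"
      using sum.reindex_bij_betw[OF h, of "\<lambda>(x,K). w K"] by (simp add: case_prod_beta)
    have "(\<Sum>k<card p. v k - u k) = (\<Sum>(x,K)\<in>p. measure lborel K)"
      unfolding reindex using uv by (intro sum.cong) auto
    with small have "(\<Sum>k<card p. v k - u k) < \<delta>" by simp
    with uv disj have "(\<Sum>k<card p. \<bar>F (v k) - F (u k)\<bar>) < \<epsilon>"
      by (intro \<delta>[rule_format]) simp
    then show ?thesis unfolding reindex u_def v_def .
  qed
  with \<open>\<delta> > 0\<close> show ?thesis using that by blast
qed

text \<open>The interiors are pairwise disjoint, so the contents add up to the measure of the union.
  An interval carrying two different tags has empty interior, hence content 0, which allows the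
  passage from pairs to intervals.\<close>

lemma sum_content_tagged_partial_division_le:
  fixes T :: "real set"
  assumes p: "p tagged_partial_division_of S" and T: "T \<in> lmeasurable" "\<And>x K. (x,K) \<in> p \<Longrightarrow> K \<subseteq> T"
  shows "(\<Sum>(x,K)\<in>p. measure lborel K) \<le> measure lebesgue T"
proof -
  note q = tagged_partial_division_of_Union_self[OF p]
  have "(\<Sum>(x,K)\<in>p. measure lborel K) = sum (measure lborel) (snd ` p)"
    by (rule sum.over_tagged_division_lemma[OF q]) (simp add: content_eq_0_interior)
  also have "\<dots> = measure lebesgue (\<Union>(snd ` p))"
  proof -
    have "sum (measure lborel) (snd ` p) = sum (measure lebesgue) (snd ` p)"
      using division_ofD(4)[OF division_of_tagged_division[OF q]] by (intro sum.cong) fastforce+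
    then show ?thesis
      using content_division[OF division_of_tagged_division[OF q]] by simp
  qed
  also have "\<dots> \<le> measure lebesgue T"
  proof (rule measure_mono_fmeasurable[OF _ _ T(1)])
    show "\<Union>(snd ` p) \<subseteq> T" using T(2) by fastforce
    show "\<Union>(snd ` p) \<in> sets lebesgue"
      using lmeasurable_division[OF division_of_tagged_division[OF q]] by (rule fmeasurableD)
  qed
  finally show ?thesis .
qed

text \<open>Intervals tagged outside \<open>N\<close> are handled by differentiability at the tag.
  Those tagged in \<open>N\<close> are forced into an open set of measure less than the \<delta> of
  absolute continuity, so the increments of \<open>F\<close> over them have a small sum; replacing
  \<open>f\<close> by 0 on \<open>N\<close> leaves no other contribution from these tags.\<close>

lemma has_integral_abs_continuous_on:
  fixes F f :: "real \<Rightarrow> real"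
  assumes "a \<le> b" and ac: "abs_continuous_on a b F" and N: "negligible N"
    and der: "\<And>x. x \<in> {a..b} - N \<Longrightarrow> (F has_vector_derivative f x) (at x within {a..b})"
  shows "(f has_integral F b - F a) {a..b}"
proof -
  define g where "g x = (if x \<in> N then 0 else f x)" for x
  have "(g has_integral F b - F a) (cbox a b)"
    unfolding has_integral
  proof (intro allI impI)
    fix e :: real assume "e > 0"
    obtain \<delta> where "\<delta> > 0" and \<delta>: "\<And>p. p tagged_partial_division_of {a..b} \<Longrightarrow> (\<Sum>(x,K)\<in>p. measure lborel K) < \<delta>
      \<Longrightarrow> (\<Sum>(x,K)\<in>p. \<bar>F (Sup K) - F (Inf K)\<bar>) < e/2"
      using abs_continuous_on_tagged_partial_division[OF ac, of "e/2"] \<open>e > 0\<close> by auto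
    obtain T where T: "open T" "N \<subseteq> T" "T - N \<in> lmeasurable" "emeasure lebesgue (T - N) < ennreal \<delta>"
      using sets_lebesgue_outer_open[of N \<delta>] N \<open>\<delta> > 0\<close>
      by (metis fmeasurableD negligible_imp_measurable)
    have Tm: "T \<in> lmeasurable"
      using T N by (metis Diff_partition fmeasurable.Un negligible_imp_measurable)
    have "measure lebesgue T = measure lebesgue (T - N)"
      using N T(1) by (simp add: measure_Diff_null_set negligible_iff_null_sets)
    then have Tless: "measure lebesgue T < \<delta>"
      using T(3,4) by (metis emeasure_eq_measure2 ennreal_less_iff measure_nonneg)
    \<comment> \<open>The errors at tags off \<open>N\<close> total at most
      \<open>e' * (b - a)\<close>, which this choice keeps below \<open>e/2\<close>; the summand 1
      covers \<open>a = b\<close>.\<close>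
    define e' where "e' = e / (2 * (b - a + 1))"
    have "e' > 0" using \<open>e > 0\<close> \<open>a \<le> b\<close> by (simp add: e'_def)
    have "\<exists>d>0. \<forall>y\<in>{a..b}. \<bar>y - x\<bar> < d \<longrightarrow> \<bar>F y - F x - f x * (y - x)\<bar> \<le> e' * \<bar>y - x\<bar>"
      if "x \<in> {a..b} - N" for x
      using der[OF that] \<open>e' > 0\<close>
      unfolding has_vector_derivative_def has_derivative_within_alt by (auto simp: mult.commute)
    then obtain d where d: "\<And>x. x \<in> {a..b} - N \<Longrightarrow> d x > 0"
      "\<And>x y. x \<in> {a..b} - N \<Longrightarrow> y \<in> {a..b} \<Longrightarrow> \<bar>y - x\<bar> < d x \<Longrightarrow> \<bar>F y - F x - f x * (y - x)\<bar> \<le> e' * \<bar>y - x\<bar>"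
      by metis
    define \<gamma> where "\<gamma> x = (if x \<in> N then T else if x \<in> {a..b} then ball x (d x) else UNIV)" for x
    have gauge: "gauge \<gamma>"
      using T d(1) by (auto simp: gauge_def \<gamma>_def)
    have Riemann: "norm ((\<Sum>(x,K)\<in>p. measure lborel K *\<^sub>R g x) - (F b - F a)) < e"
      if p: "p tagged_division_of cbox a b" and fine: "\<gamma> fine p" for p
    proof -
      have pp: "p tagged_partial_division_of {a..b}" using p by (simp add: tagged_division_of_def)
      note pD = tagged_partial_division_ofD[OF pp]
      define q where "q = {(x,K)\<in>p. x \<in> N}"
      have "q \<subseteq> p" by (auto simp: q_def)
      have qp: "q tagged_partial_division_of {a..b}"
        using pp \<open>q \<subseteq> p\<close> by (rule tagged_partial_division_subset)
      have "(\<Sum>(x,K)\<in>q. measure lborel K) \<le> measure lebesgue T"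
        using fineD[OF fine] by (intro sum_content_tagged_partial_division_le[OF qp Tm]) (fastforce simp: q_def \<gamma>_def)
      then have 1: "(\<Sum>(x,K)\<in>q. \<bar>F (Sup K) - F (Inf K)\<bar>) < e/2"
        using \<delta>[OF qp] Tless by simp
      have good: "\<bar>measure lborel K * g x - (F (Sup K) - F (Inf K))\<bar> \<le> e' * measure lborel K" if "(x,K) \<in> p - q" for x K
      proof -
        have xK: "(x,K) \<in> p" "x \<notin> N" using that by (auto simp: q_def)
        then obtain u v where K: "K = {u..v}" "x \<in> {u..v}" "K \<subseteq> {a..b}"
          using pD(2,3,4) by (metis cbox_interval)
        then have uv: "u \<le> x" "x \<le> v" "a \<le> u" "v \<le> b" by auto
        have "K \<subseteq> ball x (d x)" using fineD[OF fine xK(1)] xK uv by (simp add: \<gamma>_def)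
        moreover have "u \<in> K" "v \<in> K" using K(1) uv by simp_all
        ultimately have "u \<in> ball x (d x)" "v \<in> ball x (d x)" by blast+
        then have "\<bar>u - x\<bar> < d x" "\<bar>v - x\<bar> < d x" by (simp_all add: dist_real_def abs_minus_commute)
        \<comment> \<open>The tag lies between \<open>u\<close> and \<open>v\<close>, so the two
          errors carry the lengths \<open>x - u\<close> and \<open>v - x\<close>, which add up to
          the length of \<open>K\<close>.\<close>
        with d(2)[of x u] d(2)[of x v] uv xK
        have "\<bar>F u - F x - f x * (u - x)\<bar> \<le> e' * (x - u)" "\<bar>F v - F x - f x * (v - x)\<bar> \<le> e' * (v - x)"
          by auto
        then show ?thesis using K uv xK by (simp add: g_def algebra_simps abs_le_iff)
      qed
      have "(\<Sum>(x,K)\<in>p. measure lborel K *\<^sub>R g x) - (F b - F a)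
          = (\<Sum>(x,K)\<in>p. measure lborel K * g x - (F (Sup K) - F (Inf K)))"
        using additive_tagged_division_1[OF \<open>a \<le> b\<close>, of p F] p by (simp add: sum_subtractf case_prod_beta)
      also have "\<dots> = (\<Sum>(x,K)\<in>p - q. measure lborel K * g x - (F (Sup K) - F (Inf K)))
            + (\<Sum>(x,K)\<in>q. measure lborel K * g x - (F (Sup K) - F (Inf K)))"
        using \<open>q \<subseteq> p\<close> pD(1) by (rule sum.subset_diff)
      also have "\<bar>\<dots>\<bar> \<le> (\<Sum>(x,K)\<in>p - q. e' * measure lborel K) + (\<Sum>(x,K)\<in>q. \<bar>F (Sup K) - F (Inf K)\<bar>)"
      proof (intro order_trans[OF abs_triangle_ineq] add_mono)
        show "\<bar>\<Sum>(x,K)\<in>p - q. measure lborel K * g x - (F (Sup K) - F (Inf K))\<bar> \<le> (\<Sum>(x,K)\<in>p - q. e' * measure lborel K)"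
          using good by (intro order_trans[OF sum_abs] sum_mono) auto
        show "\<bar>\<Sum>(x,K)\<in>q. measure lborel K * g x - (F (Sup K) - F (Inf K))\<bar> \<le> (\<Sum>(x,K)\<in>q. \<bar>F (Sup K) - F (Inf K)\<bar>)"
          by (intro order_trans[OF sum_abs] sum_mono) (auto simp: q_def g_def abs_minus_commute)
      qed
      also have "(\<Sum>(x,K)\<in>p - q. e' * measure lborel K) \<le> (\<Sum>(x,K)\<in>p. e' * measure lborel K)"
        using pD(1) \<open>e' > 0\<close> by (intro sum_mono2) auto
      also have "\<dots> = e' * (b - a)"
        using additive_content_tagged_division[OF p] \<open>a \<le> b\<close> by (simp add: case_prod_beta sum_distrib_left[symmetric])
      also have "\<dots> \<le> e/2" using \<open>e > 0\<close> \<open>a \<le> b\<close> by (simp add: e'_def field_simps)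
      finally show ?thesis using 1 by simp
    qed
    show "\<exists>\<gamma>. gauge \<gamma> \<and> (\<forall>p. p tagged_division_of cbox a b \<and> \<gamma> fine p \<longrightarrow>
        norm ((\<Sum>(x,K)\<in>p. measure lborel K *\<^sub>R g x) - (F b - F a)) < e)"
      by (intro exI[of _ \<gamma>] conjI allI impI gauge Riemann) simp_all
  qed
  then show ?thesis
    using has_integral_spike[OF N, of "{a..b}" f g] by (simp add: g_def)
qed

section \<open>Lebesgue differentiation\<close>

text \<open>Every point of the set lies in arbitrarily short intervals on which the mean of
  \<open>f\<close> is off by at least \<eta>. Vitali's theorem selects countably many disjoint ones
  that cover the set up to a null set. Henstock's lemma bounds the sum of their deviations by
  \<open>e * \<eta>\<close>, and each deviation is at least \<eta> times the length, so the total
  length is at most \<open>e\<close>.\<close>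

lemma negligible_large_integral_mean_deviation:
  fixes f :: "real \<Rightarrow> real"
  assumes f: "f integrable_on {a..b}" and "\<eta> > 0"
  shows "negligible {x\<in>{a<..<b}. \<forall>d>0. \<exists>u v. a \<le> u \<and> v \<le> b \<and> u \<le> x \<and> x \<le> v \<and> u < v \<and> v - u < d \<and>
    \<eta> * (v - u) \<le> \<bar>(v - u) * f x - integral {u..v} f\<bar>}" (is "negligible ?S")
  unfolding negligible_outer_le
proof (intro allI impI)
  fix e :: real assume "e > 0"
  obtain \<gamma> where "gauge \<gamma>"
    and \<gamma>: "\<And>p. \<lbrakk>p tagged_partial_division_of (cbox a b); \<gamma> fine p\<rbrakk> \<Longrightarrow>
      (\<Sum>(x,K)\<in>p. norm (measure lborel K *\<^sub>R f x - integral K f)) < e * \<eta>"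
  proof (rule Henstock_lemma[of f a b "e * \<eta>"])
    show "f integrable_on cbox a b" "0 < e * \<eta>" using f \<open>e > 0\<close> \<open>\<eta> > 0\<close> by auto
  qed (rule that)
  define K where "K = {(x,u,v). u < v \<and> x \<in> {u..v} \<and> {u..v} \<subseteq> {a..b} \<and> {u..v} \<subseteq> \<gamma> x \<and>
    \<eta> * (v - u) \<le> \<bar>(v - u) * f x - integral {u..v} f\<bar>}"
  define J where "J = (\<lambda>(x::real,u,v). {u..v::real})"
  \<comment> \<open>Midpoint and half-length, because Vitali's theorem is applied to closed
    balls.\<close>
  define m where "m = (\<lambda>(x::real,u,v). (u + v) / 2 :: real)"
  define r where "r = (\<lambda>(x::real,u,v). (v - u) / 2 :: real)"
  have cball: "cball (m i) (r i) = J i" for i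
    by (cases i) (auto simp: m_def r_def J_def cball_eq_atLeastAtMost field_simps)
  obtain C where C: "countable C" "C \<subseteq> K" "pairwise (\<lambda>i j. disjnt (J i) (J j)) C"
    "negligible (?S - (\<Union>i\<in>C. J i))"
  proof (rule Vitali_covering_theorem_cballs[of K r ?S m, unfolded cball])
    show "0 < r i" if "i \<in> K" for i using that by (auto simp: K_def r_def)
    show "\<exists>i. i \<in> K \<and> x \<in> J i \<and> r i < d" if x: "x \<in> ?S" and "0 < d" for x d
    proof -
      obtain \<delta> where \<delta>: "\<delta> > 0" "ball x \<delta> \<subseteq> \<gamma> x"
        using \<open>gauge \<gamma>\<close> by (meson gauge_def open_contains_ball)
      have "min \<delta> d > 0" using \<delta> \<open>0 < d\<close> by simp
      then obtain u v where uv: "a \<le> u" "v \<le> b" "u \<le> x" "x \<le> v" "u < v" "v - u < min \<delta> d"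
          "\<eta> * (v - u) \<le> \<bar>(v - u) * f x - integral {u..v} f\<bar>"
        using x by blast
      then have "{u..v} \<subseteq> ball x \<delta>" by (auto simp: dist_real_def)
      then have "(x,u,v) \<in> K" using uv \<delta> by (auto simp: K_def)
      moreover have "x \<in> J (x,u,v)" "r (x,u,v) < d" using uv by (auto simp: J_def r_def)
      ultimately show ?thesis by blast
    qed
  qed (use that in blast)
  have J_meas: "J i \<in> lmeasurable" for i by (cases i) (auto simp: J_def)
  \<comment> \<open>Tagged divisions are finite, so the length is estimated for finite subfamilies
    and the bound then carries over to the countable union.\<close>
  have fin: "measure lebesgue (\<Union>i\<in>D. J i) \<le> e" if "D \<subseteq> C" "finite D" for D
  proof -
    define p where "p = (\<lambda>i. (fst i, J i)) ` D"
    have DK: "D \<subseteq> K" and disj: "pairwise (\<lambda>i j. disjnt (J i) (J j)) D"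
      using that C(2,3) by (auto intro: pairwise_subset)
    have p: "p tagged_partial_division_of (cbox a b)"
      unfolding tagged_partial_division_of_def
    proof (intro conjI allI impI)
      show "finite p" using that by (simp add: p_def)
    next
      fix x L assume "(x,L) \<in> p"
      then obtain u v where "(x,u,v) \<in> D" "L = {u..v}" by (auto simp: p_def J_def)
      then show "x \<in> L" "L \<subseteq> cbox a b" "\<exists>c d. L = cbox c d" using DK by (auto simp: K_def)
    next
      fix x1 K1 x2 K2 assume "(x1, K1) \<in> p \<and> (x2, K2) \<in> p \<and> (x1, K1) \<noteq> (x2, K2)"
      then obtain i j where ij: "i \<in> D" "j \<in> D" "(x1,K1) = (fst i, J i)" "(x2,K2) = (fst j, J j)"
        and "(x1,K1) \<noteq> (x2,K2)"
        unfolding p_def by blast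
      then have "i \<noteq> j" "K1 = J i" "K2 = J j" by auto
      with ij(1,2) have "disjnt K1 K2" using disj by (auto simp: pairwise_def)
      then show "interior K1 \<inter> interior K2 = {}"
        using interior_subset[of K1] interior_subset[of K2] by (auto simp: disjnt_def)
    qed
    have fine: "\<gamma> fine p"
      using DK by (fastforce simp: p_def J_def K_def intro!: fineI)
    have inj: "inj_on (\<lambda>i. (fst i, J i)) D"
    proof (rule inj_onI)
      fix i j assume ij: "i \<in> D" "j \<in> D" "(fst i, J i) = (fst j, J j)"
      have "J i \<noteq> {}" using ij(1) DK by (auto simp: K_def J_def)
      then show "i = j" using ij disj by (auto simp: pairwise_def disjnt_def)
    qed
    have "measure lebesgue (\<Union>i\<in>D. J i) \<le> (\<Sum>i\<in>D. measure lebesgue (J i))"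
      using that(2) J_meas by (intro measure_UNION_le) auto
    also have "\<dots> \<le> (\<Sum>i\<in>D. norm (measure lborel (J i) *\<^sub>R f (fst i) - integral (J i) f) / \<eta>)"
      using DK \<open>\<eta> > 0\<close> by (intro sum_mono) (auto simp: K_def J_def field_simps)
    also have "\<dots> = (\<Sum>(x,L)\<in>p. norm (measure lborel L *\<^sub>R f x - integral L f)) / \<eta>"
      unfolding p_def sum.reindex[OF inj] by (simp add: sum_divide_distrib)
    also have "\<dots> \<le> e" using \<gamma>[OF p fine] \<open>\<eta> > 0\<close> by (simp add: field_simps)
    finally show ?thesis .
  qed
  define U where "U = (\<Union>i\<in>C. J i)"
  have U: "U \<in> lmeasurable" "measure lebesgue U \<le> e"
    unfolding U_def using fmeasurable_UN_bound[OF C(1) J_meas fin] measure_UN_bound[OF C(1) J_meas fin] by auto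
  have null: "?S - U \<in> null_sets lebesgue" using C(4) by (simp add: U_def negligible_iff_null_sets)
  show "\<exists>T. ?S \<subseteq> T \<and> T \<in> lmeasurable \<and> measure lebesgue T \<le> e"
  proof (intro exI conjI)
    show "?S \<subseteq> U \<union> (?S - U)" by blast
    show "U \<union> (?S - U) \<in> lmeasurable"
      by (rule fmeasurable.Un[OF U(1) fmeasurableI_null_sets[OF null]])
    show "measure lebesgue (U \<union> (?S - U)) \<le> e"
      using U null by (subst measure_Un_null_set) auto
  qed
qed

text \<open>The exceptional sets for \<eta> = 1/(n+1) have a negligible union. Outside it the mean
  over every short interval ending or starting at \<open>x\<close> is close to \<open>f x\<close>,
  and the difference quotients of the primitive are such means.\<close>

theorem lebesgue_differentiation_real:
  fixes f :: "real \<Rightarrow> real"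
  assumes f: "f integrable_on {a..b}"
  obtains N where "negligible N"
    "\<And>x. x \<in> {a<..<b} - N \<Longrightarrow> ((\<lambda>t. integral {a..t} f) has_real_derivative f x) (at x)"
proof -
  define P where "P \<eta> x d \<longleftrightarrow> (\<exists>u v. a \<le> u \<and> v \<le> b \<and> u \<le> x \<and> x \<le> v \<and> u < v \<and> v - u < d \<and>
    \<eta> * (v - u) \<le> \<bar>(v - u) * f x - integral {u..v} f\<bar>)" for \<eta> x d
  define S where "S \<eta> = {x\<in>{a<..<b}. \<forall>d>0. P \<eta> x d}" for \<eta>
  show ?thesis
  proof
    show "negligible (\<Union>n. S (inverse (real (Suc n))))"
      using negligible_large_integral_mean_deviation[OF f] unfolding S_def P_def
      by (intro negligible_Union_nat) simp
    fix x assume x: "x \<in> {a<..<b} - (\<Union>n. S (inverse (real (Suc n))))"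
    show "((\<lambda>t. integral {a..t} f) has_real_derivative f x) (at x)"
      unfolding has_field_derivative_def has_derivative_within_alt
    proof (intro conjI allI impI)
      fix e :: real assume "e > 0"
      then obtain n where n: "inverse (real (Suc n)) < e" using reals_Archimedean by blast
      have "x \<notin> S (inverse (real (Suc n)))" using x by blast
      then obtain d where "d > 0" and "\<not> P (inverse (real (Suc n))) x d"
        using x unfolding S_def by blast
      then have d: "\<bar>(v - u) * f x - integral {u..v} f\<bar> < inverse (real (Suc n)) * (v - u)"
        if "a \<le> u" "v \<le> b" "u \<le> x" "x \<le> v" "u < v" "v - u < d" for u v
        using that unfolding P_def by (meson not_le)
      define d' where "d' = Min {d, x - a, b - x}"
      have d': "d' > 0" "d' \<le> d" "d' \<le> x - a" "d' \<le> b - x" using x \<open>d > 0\<close> by (auto simp: d'_def)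
      have "norm (integral {a..y} f - integral {a..x} f - f x * (y - x)) \<le> e * norm (y - x)"
        if "norm (y - x) < d'" for y
      proof -
        define u where "u = min x y"
        define v where "v = max x y"
        have uv: "a \<le> u" "v \<le> b" "u \<le> x" "x \<le> v" "v - u < d" "v - u = \<bar>y - x\<bar>" "u \<le> v"
          using that d' x by (auto simp: u_def v_def min_def max_def)
        have "f integrable_on {a..v}"
          using f by (rule integrable_on_subinterval) (use uv in auto)
        then have "integral {a..u} f + integral {u..v} f = integral {a..v} f"
          using uv by (intro Henstock_Kurzweil_Integration.integral_combine) auto
        then have "\<bar>integral {a..y} f - integral {a..x} f - f x * (y - x)\<bar> = \<bar>(v - u) * f x - integral {u..v} f\<bar>"
          by (auto simp: u_def v_def min_def max_def algebra_simps split: if_splits)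
        also have "\<dots> \<le> e * (v - u)"
        proof (cases "u = v")
          case False
          then have "\<bar>(v - u) * f x - integral {u..v} f\<bar> < inverse (real (Suc n)) * (v - u)"
            using uv by (intro d) auto
          also have "\<dots> \<le> e * (v - u)" using n uv by (intro mult_right_mono) auto
          finally show ?thesis by simp
        qed simp
        finally show ?thesis using uv by simp
      qed
      then show "\<exists>d>0. \<forall>y\<in>UNIV. norm (y - x) < d \<longrightarrow>
          norm (integral {a..y} f - integral {a..x} f - f x * (y - x)) \<le> e * norm (y - x)"
        using d' by blast
    qed (simp add: bounded_linear_mult_right)
  qed
qed

section \<open>Fractional integrals of bounded Borel functions\<close>

lemma frac_kernel_nonneg: "0 < \<beta> \<Longrightarrow> 0 \<le> frac_kernel \<beta> t \<tau>"
  by (simp add: frac_kernel_def Gamma_real_nonneg)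

lemma borel_measurable_frac_kernel [measurable (raw)]:
  assumes [measurable]: "f \<in> borel_measurable M" "g \<in> borel_measurable M"
  shows "(\<lambda>x. frac_kernel \<beta> (f x) (g x)) \<in> borel_measurable M"
  unfolding frac_kernel_def by measurable

text \<open>The antiderivative -(t - \<tau>)^\<beta> / \<beta> is continuous up to \<tau> = t, where
  the kernel itself is singular for \<beta> < 1; hence the form of the fundamental theorem that
  differentiates only in the interior.\<close>

lemma has_integral_frac_kernel:
  assumes "0 < \<beta>" "c \<le> d" "d \<le> t"
  shows "(frac_kernel \<beta> t has_integral ((t - c) powr \<beta> - (t - d) powr \<beta>) / Gamma (\<beta> + 1)) {c..d}"
proof -
  have *: "((\<lambda>\<tau>. (t - \<tau>) powr (\<beta> - 1)) has_integral - ((t - d) powr \<beta> / \<beta>) - - ((t - c) powr \<beta> / \<beta>)) {c..d}"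
  proof (rule fundamental_theorem_of_calculus_interior[OF \<open>c \<le> d\<close>])
    show "continuous_on {c..d} (\<lambda>\<tau>. - ((t - \<tau>) powr \<beta> / \<beta>))"
      using assms by (intro continuous_intros continuous_on_powr') auto
    show "((\<lambda>\<tau>. - ((t - \<tau>) powr \<beta> / \<beta>)) has_vector_derivative (t - x) powr (\<beta> - 1)) (at x)" if "x \<in> {c<..<d}" for x
      using assms that unfolding has_real_derivative_iff_has_vector_derivative[symmetric]
      by (auto intro!: derivative_eq_intros)
  qed
  have "\<beta> \<notin> \<int>\<^sub>\<le>\<^sub>0" using assms by (auto elim!: nonpos_Ints_cases)
  then have "Gamma (\<beta> + 1) = \<beta> * Gamma \<beta>" by (rule Gamma_plus1)
  then have "1 / Gamma \<beta> * (- ((t - d) powr \<beta> / \<beta>) - - ((t - c) powr \<beta> / \<beta>))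
      = ((t - c) powr \<beta> - (t - d) powr \<beta>) / Gamma (\<beta> + 1)"
    by (simp add: diff_divide_distrib mult.commute)
  with has_integral_mult_right[OF *, of "1 / Gamma \<beta>"] show ?thesis
    unfolding frac_kernel_def by (simp only:)
qed

text \<open>Nonnegative gauge integrable functions are Lebesgue integrable with the same value; this
  carries the antiderivative and Beta computations over to Bochner integrals.\<close>

lemma set_integrable_lborel_nonneg:
  fixes f :: "real \<Rightarrow> real"
  assumes [measurable]: "f \<in> borel_measurable borel" "S \<in> sets borel"
    and "(f has_integral y) S" "\<And>x. x \<in> S \<Longrightarrow> 0 \<le> f x"
  shows "set_integrable lborel S f" "(LINT x:S|lborel. f x) = y"
proof -
  have "f absolutely_integrable_on S"
    using assms by (intro nonnegative_absolutely_integrable_1) auto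
  then show *: "set_integrable lborel S f"
    unfolding set_integrable_def by (subst (asm) integrable_completion) auto
  show "(LINT x:S|lborel. f x) = y"
    using set_borel_integral_eq_integral[OF *] assms(3) by auto
qed

lemma frac_kernel_lborel:
  assumes "0 < \<beta>" "c \<le> d" "d \<le> t"
  shows "set_integrable lborel {c..d} (frac_kernel \<beta> t)"
    and "(LINT \<tau>:{c..d}|lborel. frac_kernel \<beta> t \<tau>) = ((t - c) powr \<beta> - (t - d) powr \<beta>) / Gamma (\<beta> + 1)"
  by (rule set_integrable_lborel_nonneg[OF _ _ has_integral_frac_kernel[OF assms]];
      simp add: frac_kernel_nonneg assms)+

text \<open>The substitution \<tau> = s + l x with l = t - s turns the product of the kernels into
  the Beta integral on [0,1].\<close>

lemma has_integral_frac_kernel_product: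
  assumes "0 < \<alpha>" "0 < \<beta>" "s < t"
  shows "((\<lambda>\<tau>. frac_kernel \<alpha> t \<tau> * frac_kernel \<beta> \<tau> s) has_integral frac_kernel (\<alpha> + \<beta>) t s) {s..t}"
proof -
  define l where "l = t - s"
  have "l > 0" using assms by (simp add: l_def)
  have "((\<lambda>x. x powr (\<beta> - 1) * (1 - x) powr (\<alpha> - 1)) has_integral Beta \<beta> \<alpha>) (cbox 0 1)"
    using has_integral_Beta_real[of \<beta> \<alpha>] assms by simp
  from has_integral_affinity[OF this, of "1 / l" "- s / l"]
  have "((\<lambda>\<tau>. ((\<tau> - s) / l) powr (\<beta> - 1) * (1 - (\<tau> - s) / l) powr (\<alpha> - 1)) has_integral l * Beta \<beta> \<alpha>)
      ((\<lambda>x. l * x + s) ` {0..1})"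
    using \<open>l > 0\<close> by (simp add: diff_divide_distrib)
  moreover have "(\<lambda>x. l * x + s) ` {0..1} = {s..t}"
    using \<open>l > 0\<close> image_affinity_atLeastAtMost[of l s 0 1] by (simp add: l_def)
  ultimately have "((\<lambda>\<tau>. ((\<tau> - s) / l) powr (\<beta> - 1) * (1 - (\<tau> - s) / l) powr (\<alpha> - 1)) has_integral l * Beta \<beta> \<alpha>) {s..t}"
    by simp
  \<comment> \<open>The power of \<open>l\<close> collects what the two kernels release under the
    substitution. The Jacobian adds one more factor \<open>l\<close>, and
    \<open>Beta \<beta> \<alpha>\<close> reduces the Gamma factors to 1 / Gamma (\<alpha> +
    \<beta>).\<close>
  from has_integral_mult_right[OF this, of "l powr (\<alpha> + \<beta> - 2) / (Gamma \<alpha> * Gamma \<beta>)"]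
  have *: "((\<lambda>\<tau>. l powr (\<alpha> + \<beta> - 2) / (Gamma \<alpha> * Gamma \<beta>) *
      (((\<tau> - s) / l) powr (\<beta> - 1) * (1 - (\<tau> - s) / l) powr (\<alpha> - 1))) has_integral
      l powr (\<alpha> + \<beta> - 2) / (Gamma \<alpha> * Gamma \<beta>) * (l * Beta \<beta> \<alpha>)) {s..t}" .
  have "l powr (\<alpha> + \<beta> - 2) * l = l powr (\<alpha> + \<beta> - 1)"
    using \<open>l > 0\<close> powr_add[of l "\<alpha> + \<beta> - 2" 1] by simp
  moreover have "l powr (\<alpha> + \<beta> - 2) / (Gamma \<alpha> * Gamma \<beta>) * (l * Beta \<beta> \<alpha>)
      = (l powr (\<alpha> + \<beta> - 2) * l) * Beta \<beta> \<alpha> / (Gamma \<alpha> * Gamma \<beta>)"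
    by simp
  ultimately have "l powr (\<alpha> + \<beta> - 2) / (Gamma \<alpha> * Gamma \<beta>) * (l * Beta \<beta> \<alpha>) = frac_kernel (\<alpha> + \<beta>) t s"
    using Gamma_real_pos[OF assms(1)] Gamma_real_pos[OF assms(2)]
    by (simp add: Beta_def frac_kernel_def l_def add.commute)
  moreover have "l powr (\<alpha> + \<beta> - 2) / (Gamma \<alpha> * Gamma \<beta>) *
      (((\<tau> - s) / l) powr (\<beta> - 1) * (1 - (\<tau> - s) / l) powr (\<alpha> - 1)) = frac_kernel \<alpha> t \<tau> * frac_kernel \<beta> \<tau> s"
    if "\<tau> \<in> {s..t}" for \<tau>
  proof -
    have "1 - (\<tau> - s) / l = (t - \<tau>) / l" using \<open>l > 0\<close> by (simp add: l_def field_simps)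
    moreover have "l powr (\<alpha> + \<beta> - 2) = l powr (\<alpha> - 1) * l powr (\<beta> - 1)"
      by (simp add: powr_add[symmetric])
    ultimately show ?thesis
      using that \<open>l > 0\<close> by (simp add: powr_divide frac_kernel_def)
  qed
  ultimately show ?thesis
    using has_integral_eq[OF _ *] by simp
qed

lemma frac_kernel_convolution:
  assumes "0 < \<alpha>" "0 < \<beta>" "s \<le> t"
  shows "(LINT \<tau>:{s..t}|lborel. frac_kernel \<alpha> t \<tau> * frac_kernel \<beta> \<tau> s) = frac_kernel (\<alpha> + \<beta>) t s"
proof (cases "s = t")
  case True
  then have *: "(\<lambda>\<tau>. indicat_real {s..t} \<tau> *\<^sub>R (frac_kernel \<alpha> t \<tau> * frac_kernel \<beta> \<tau> s)) = (\<lambda>_. 0)"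
    by (auto simp: frac_kernel_def split: split_indicator)
  show ?thesis
    unfolding set_lebesgue_integral_def * using True by (simp add: frac_kernel_def)
next
  case False
  with assms has_integral_frac_kernel_product[of \<alpha> \<beta> s t] show ?thesis
    by (intro set_integrable_lborel_nonneg(2)) (auto intro!: mult_nonneg_nonneg frac_kernel_nonneg)
qed

lemma left_frac_int_raw_lborel:
  assumes [measurable]: "v \<in> borel_measurable borel" and "0 < \<beta>"
  shows "left_frac_int_raw a \<beta> v t = (LINT \<tau>:{a..t}|lborel. frac_kernel \<beta> t \<tau> * v \<tau>)"
  using assms(2) unfolding left_frac_int_raw_def set_lebesgue_integral_def
  by (simp add: integral_completion)

lemma set_integrable_frac_kernel_mult:
  assumes [measurable]: "v \<in> borel_measurable borel" and v: "\<And>\<tau>. \<bar>v \<tau>\<bar> \<le> M" and "0 < \<beta>" "c \<le> d" "d \<le> t"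
  shows "set_integrable lborel {c..d} (\<lambda>\<tau>. frac_kernel \<beta> t \<tau> * v \<tau>)"
proof (rule set_integrable_bound)
  show "set_integrable lborel {c..d} (\<lambda>\<tau>. frac_kernel \<beta> t \<tau> * M)"
    using frac_kernel_lborel(1)[OF assms(3-5)] by simp
  have "frac_kernel \<beta> t \<tau> * \<bar>v \<tau>\<bar> \<le> \<bar>frac_kernel \<beta> t \<tau> * M\<bar>" for \<tau>
    using v[of \<tau>] frac_kernel_nonneg[OF \<open>0 < \<beta>\<close>, of t \<tau>]
    by (simp add: abs_mult mult_left_mono)
  then show "AE \<tau> in lborel. \<tau> \<in> {c..d} \<longrightarrow> norm (frac_kernel \<beta> t \<tau> * v \<tau>) \<le> norm (frac_kernel \<beta> t \<tau> * M)"
    using frac_kernel_nonneg[OF \<open>0 < \<beta>\<close>] by (simp add: abs_mult)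
qed (simp add: set_borel_measurable_def)

lemma abs_LINT_mult_le:
  fixes w v :: "real \<Rightarrow> real"
  assumes [measurable]: "v \<in> borel_measurable borel" and v: "\<And>\<tau>. \<bar>v \<tau>\<bar> \<le> M"
    and w: "set_integrable lborel S w" "\<And>x. x \<in> S \<Longrightarrow> 0 \<le> w x"
  shows "\<bar>LINT x:S|lborel. w x * v x\<bar> \<le> M * (LINT x:S|lborel. w x)"
proof -
  have "norm (LINT x:S|lborel. w x * v x) \<le> (LINT x:S|lborel. w x * M)"
    unfolding set_lebesgue_integral_def
  proof (rule Bochner_Integration.integral_norm_bound_integral)
    show wM: "integrable lborel (\<lambda>x. indicat_real S x *\<^sub>R (w x * M))"
      using w(1) set_integrable_mult_left[of M lborel S w] by (simp add: set_integrable_def)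
    show le: "norm (indicat_real S x *\<^sub>R (w x * v x)) \<le> indicat_real S x *\<^sub>R (w x * M)" for x
      using v[of x] w(2)[of x] by (auto simp: abs_mult mult_left_mono split: split_indicator)
    have [measurable]: "(\<lambda>x. indicat_real S x * w x) \<in> borel_measurable borel"
      using w(1) by (auto simp: set_integrable_def dest!: borel_measurable_integrable)
    have "(\<lambda>x. indicat_real S x * w x * v x) \<in> borel_measurable lborel" by measurable
    then show "integrable lborel (\<lambda>x. indicat_real S x *\<^sub>R (w x * v x))"
      using order_trans[OF le abs_ge_self] by (intro Bochner_Integration.integrable_bound[OF wM]) (auto simp: mult.assoc simp del: abs_mult)
  qed
  then show ?thesis by (simp add: mult.commute)
qed

text \<open>Splitting at \<open>s\<close> leaves the kernel at \<open>t\<close> over [s,t] and the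
  difference of the kernels at \<open>s\<close> and \<open>t\<close> over [a,s]. For \<beta> \<le> 1
  that difference is nonnegative when \<tau> < s, so it can be integrated exactly. Each part is at
  most M (t - s)^\<beta> / Gamma (\<beta> + 1), whence the factor 2.\<close>

lemma left_frac_int_raw_holder:
  assumes v: "v \<in> borel_measurable borel" "\<And>\<tau>. \<bar>v \<tau>\<bar> \<le> M" and \<beta>: "0 < \<beta>" "\<beta> \<le> 1" and st: "a \<le> s" "s \<le> t"
  shows "\<bar>left_frac_int_raw a \<beta> v t - left_frac_int_raw a \<beta> v s\<bar> \<le> 2 * M / Gamma (\<beta> + 1) * (t - s) powr \<beta>"
proof -
  note int = set_integrable_frac_kernel_mult[OF v \<beta>(1)]
  let ?I = "\<lambda>c d w. LINT \<tau>:{c..d}|lborel. w \<tau> :: real"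
  have [simp]: "M \<ge> 0" using v(2)[of 0] by linarith
  have "?I a t (\<lambda>\<tau>. frac_kernel \<beta> t \<tau> * v \<tau>) =
      ?I a s (\<lambda>\<tau>. frac_kernel \<beta> t \<tau> * v \<tau>) + ?I s t (\<lambda>\<tau>. frac_kernel \<beta> t \<tau> * v \<tau>)"
  proof -
    have "{a..t} = {a..s} \<union> {s..t}" using st by auto
    moreover have "AE x in lborel. \<not> (x \<in> {a..s} \<and> x \<in> {s..t})"
      using AE_lborel_singleton[of s] by eventually_elim auto
    ultimately show ?thesis
      using st by (simp add: set_integral_Un_AE int)
  qed
  then have "left_frac_int_raw a \<beta> v t - left_frac_int_raw a \<beta> v s =
      ?I s t (\<lambda>\<tau>. frac_kernel \<beta> t \<tau> * v \<tau>) - ?I a s (\<lambda>\<tau>. (frac_kernel \<beta> s \<tau> - frac_kernel \<beta> t \<tau>) * v \<tau>)"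
    using st by (simp add: left_frac_int_raw_lborel v \<beta> left_diff_distrib int)
  moreover have "\<bar>?I s t (\<lambda>\<tau>. frac_kernel \<beta> t \<tau> * v \<tau>)\<bar> \<le> M / Gamma (\<beta> + 1) * (t - s) powr \<beta>"
    using abs_LINT_mult_le[OF v frac_kernel_lborel(1), of \<beta> s t t] frac_kernel_lborel(2)[of \<beta> s t t] \<beta> st
    by (simp add: frac_kernel_nonneg)
  moreover have "\<bar>?I a s (\<lambda>\<tau>. (frac_kernel \<beta> s \<tau> - frac_kernel \<beta> t \<tau>) * v \<tau>)\<bar> \<le> M / Gamma (\<beta> + 1) * (t - s) powr \<beta>"
  proof -
    \<comment> \<open>At \<tau> = s the kernel at \<open>s\<close> is 0 by convention, while the
      kernel at \<open>t\<close> may be positive; resetting this point to 0 makes the weight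
      nonnegative on all of [a,s].\<close>
    let ?w = "\<lambda>\<tau>. if \<tau> = s then 0 else frac_kernel \<beta> s \<tau> - frac_kernel \<beta> t \<tau>"
    have [measurable]: "v \<in> borel_measurable borel" by fact
    have AE_s: "AE \<tau> in lborel. \<tau> \<noteq> s" by (rule AE_lborel_singleton)
    have diff: "set_integrable lborel {a..s} (\<lambda>\<tau>. frac_kernel \<beta> s \<tau> - frac_kernel \<beta> t \<tau>)"
      using \<beta> st by (intro set_integral_diff frac_kernel_lborel) auto
    have w_int: "set_integrable lborel {a..s} ?w"
      unfolding set_integrable_def
    proof (rule integrable_cong_AE_imp[OF diff[unfolded set_integrable_def]])
      show "AE \<tau> in lborel. indicat_real {a..s} \<tau> *\<^sub>R (frac_kernel \<beta> s \<tau> - frac_kernel \<beta> t \<tau>)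
          = indicat_real {a..s} \<tau> *\<^sub>R ?w \<tau>"
        using AE_s by eventually_elim simp
    qed measurable
    have w0: "0 \<le> ?w \<tau>" if "\<tau> \<in> {a..s}" for \<tau>
      using that st \<beta> by (auto simp: frac_kernel_def intro!: divide_right_mono powr_mono2' Gamma_real_nonneg)
    have eq: "?I a s (\<lambda>\<tau>. (frac_kernel \<beta> s \<tau> - frac_kernel \<beta> t \<tau>) * y \<tau>) = ?I a s (\<lambda>\<tau>. ?w \<tau> * y \<tau>)"
      if [measurable]: "y \<in> borel_measurable borel" for y
      unfolding set_lebesgue_integral_def
    proof (rule integral_cong_AE)
      show "AE \<tau> in lborel. indicat_real {a..s} \<tau> *\<^sub>R ((frac_kernel \<beta> s \<tau> - frac_kernel \<beta> t \<tau>) * y \<tau>)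
          = indicat_real {a..s} \<tau> *\<^sub>R (?w \<tau> * y \<tau>)"
        using AE_s by eventually_elim simp
    qed measurable
    have "\<bar>?I a s (\<lambda>\<tau>. (frac_kernel \<beta> s \<tau> - frac_kernel \<beta> t \<tau>) * v \<tau>)\<bar> \<le> M * ?I a s ?w"
      unfolding eq[OF v(1)] using w0 by (rule abs_LINT_mult_le[OF v w_int])
    also have "?I a s ?w = ?I a s (\<lambda>\<tau>. frac_kernel \<beta> s \<tau> - frac_kernel \<beta> t \<tau>)"
      using eq[of "\<lambda>_. 1"] by simp
    also have "\<dots> = ((s - a) powr \<beta> - ((t - a) powr \<beta> - (t - s) powr \<beta>)) / Gamma (\<beta> + 1)"
      using \<beta> st by (simp add: frac_kernel_lborel diff_divide_distrib)
    also have "\<dots> \<le> (t - s) powr \<beta> / Gamma (\<beta> + 1)"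
      using \<beta> st by (intro divide_right_mono Gamma_real_nonneg) (auto intro!: powr_mono2)
    finally show ?thesis by (simp add: mult_left_mono)
  qed
  ultimately have "\<bar>left_frac_int_raw a \<beta> v t - left_frac_int_raw a \<beta> v s\<bar> \<le> 2 * (M / Gamma (\<beta> + 1) * (t - s) powr \<beta>)"
    by linarith
  then show ?thesis by simp
qed

lemma continuous_on_left_frac_int_raw:
  assumes v: "v \<in> borel_measurable borel" "\<And>\<tau>. \<bar>v \<tau>\<bar> \<le> M" and \<beta>: "0 < \<beta>" "\<beta> \<le> 1"
  shows "continuous_on {a..} (left_frac_int_raw a \<beta> v)"
proof -
  let ?F = "left_frac_int_raw a \<beta> v"
  define c where "c = 2 * M / Gamma (\<beta> + 1)"
  have le: "\<bar>?F y - ?F x\<bar> \<le> c * \<bar>y - x\<bar> powr \<beta>" if "x \<in> {a..}" "y \<in> {a..}" for x y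
    using that left_frac_int_raw_holder[OF v \<beta>, of a x y] left_frac_int_raw_holder[OF v \<beta>, of a y x]
    by (cases "x \<le> y") (auto simp: abs_minus_commute c_def)
  show ?thesis
    unfolding continuous_on_def
  proof
    fix x assume x: "x \<in> {a..}"
    have "((\<lambda>y. \<bar>y - x\<bar> powr \<beta>) \<longlongrightarrow> \<bar>x - x\<bar> powr \<beta>) (at x within {a..})"
      using \<beta> by (intro tendsto_powr' tendsto_intros) auto
    then have "((\<lambda>y. c * \<bar>y - x\<bar> powr \<beta>) \<longlongrightarrow> 0) (at x within {a..})"
      using \<beta> tendsto_mult_left[of "\<lambda>y. \<bar>y - x\<bar> powr \<beta>" 0 _ c] by simp
    then have "((\<lambda>y. ?F y - ?F x) \<longlongrightarrow> 0) (at x within {a..})"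
      by (rule Lim_null_comparison[rotated]) (use le x in \<open>auto simp: eventually_at_filter\<close>)
    then show "(?F \<longlongrightarrow> ?F x) (at x within {a..})" by (rule LIM_zero_cancel)
  qed
qed

text \<open>Writing the moving interval as a case distinction makes the integrand jointly measurable
  in (t, \<tau>), so the parameter integral is measurable and fractional integrals can be iterated
  among Borel functions.\<close>

lemma borel_measurable_left_frac_int_raw:
  assumes [measurable]: "v \<in> borel_measurable borel"
  shows "left_frac_int_raw a \<beta> v \<in> borel_measurable borel"
proof -
  have "(\<lambda>t. if \<beta> = 0 then v t else (LINT \<tau>|lborel. (if a \<le> \<tau> \<and> \<tau> \<le> t then frac_kernel \<beta> t \<tau> * v \<tau> else 0))) \<in> borel_measurable borel"
    by measurable
  also have "(\<lambda>t. if \<beta> = 0 then v t else (LINT \<tau>|lborel. (if a \<le> \<tau> \<and> \<tau> \<le> t then frac_kernel \<beta> t \<tau> * v \<tau> else 0)))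
    = left_frac_int_raw a \<beta> v"
    by (auto simp: fun_eq_iff left_frac_int_raw_def set_lebesgue_integral_def integral_completion indicator_def
        intro!: Bochner_Integration.integral_cong)
  finally show ?thesis .
qed

text \<open>Fubini on the triangle a \<le> s \<le> \<tau> \<le> t: integrating over \<open>s\<close>
  first gives the iterated integral, integrating over \<tau> first gives the convolution of the
  kernels.\<close>

lemma left_frac_int_raw_add_order:
  assumes v [measurable]: "v \<in> borel_measurable borel" and vM: "\<And>\<tau>. \<bar>v \<tau>\<bar> \<le> M"
    and \<alpha>: "0 < \<alpha>" and \<beta>: "0 < \<beta>" and t: "a \<le> t"
  shows "left_frac_int_raw a \<alpha> (left_frac_int_raw a \<beta> v) t = left_frac_int_raw a (\<alpha> + \<beta>) v t"
proof -
  define W where "W \<tau> s = (if a \<le> s \<and> s \<le> \<tau> \<and> \<tau> \<le> t then frac_kernel \<alpha> t \<tau> * (frac_kernel \<beta> \<tau> s * v s) else 0)" for \<tau> s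
  have W[measurable]: "case_prod W \<in> borel_measurable (lborel \<Otimes>\<^sub>M lborel)"
    unfolding W_def by measurable
  have M: "M \<ge> 0" using vM[of 0] by linarith
  have W_eq: "W \<tau> s = (indicator {a..t} \<tau> * frac_kernel \<alpha> t \<tau>) * (indicator {a..\<tau>} s *\<^sub>R (frac_kernel \<beta> \<tau> s * v s))" for \<tau> s
    by (auto simp: W_def split: split_indicator)
  have W_int: "integrable lborel (W \<tau>)" for \<tau>
  proof (cases "a \<le> \<tau>")
    case True
    then show ?thesis
      using set_integrable_frac_kernel_mult[OF v vM \<beta> True order.refl]
      unfolding W_eq[abs_def] set_integrable_def by (intro integrable_mult_right)
  next
    case False
    then have "W \<tau> = (\<lambda>_. 0)" by (auto simp: W_def)
    then show ?thesis by simp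
  qed
  have inner: "(LINT s|lborel. W \<tau> s) = indicator {a..t} \<tau> *\<^sub>R (frac_kernel \<alpha> t \<tau> * left_frac_int_raw a \<beta> v \<tau>)" for \<tau>
    by (simp add: W_eq left_frac_int_raw_lborel \<beta> set_lebesgue_integral_def)
  have "integrable (lborel \<Otimes>\<^sub>M lborel) (case_prod W)"
  proof (rule lborel_pair.Fubini_integrable[OF W])
    show "AE \<tau> in lborel. integrable lborel (\<lambda>s. case_prod W (\<tau>, s))" using W_int by simp
    \<comment> \<open>A bound on [a,t] for the integral of order \<beta> of |v|; times the kernel of
      order \<alpha> it is an integrable majorant of the inner integrals.\<close>
    let ?c = "M * (t - a) powr \<beta> / Gamma (\<beta> + 1)"
    have "set_integrable lborel {a..t} (\<lambda>\<tau>. frac_kernel \<alpha> t \<tau> * ?c)"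
      using frac_kernel_lborel(1)[OF \<alpha> t] by (intro set_integrable_mult_left) simp
    then have bd: "integrable lborel (\<lambda>\<tau>. indicator {a..t} \<tau> *\<^sub>R (frac_kernel \<alpha> t \<tau> * ?c))"
      by (simp add: set_integrable_def)
    show "integrable lborel (\<lambda>\<tau>. LINT s|lborel. norm (case_prod W (\<tau>, s)))"
    proof (rule Bochner_Integration.integrable_bound[OF bd])
      show "(\<lambda>\<tau>. LINT s|lborel. norm (case_prod W (\<tau>, s))) \<in> borel_measurable lborel" by measurable
      have "(LINT s|lborel. norm (W \<tau> s)) \<le> indicator {a..t} \<tau> *\<^sub>R (frac_kernel \<alpha> t \<tau> * ?c)" for \<tau>
      proof (cases "\<tau> \<in> {a..t}")
        case True
        have "(LINT s|lborel. norm (W \<tau> s)) \<le> (LINT s|lborel. frac_kernel \<alpha> t \<tau> * M * (indicator {a..\<tau>} s *\<^sub>R frac_kernel \<beta> \<tau> s))"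
        proof (rule integral_mono)
          show "integrable lborel (\<lambda>s. norm (W \<tau> s))" using W_int by simp
          show "integrable lborel (\<lambda>s. frac_kernel \<alpha> t \<tau> * M * (indicator {a..\<tau>} s *\<^sub>R frac_kernel \<beta> \<tau> s))"
            using frac_kernel_lborel(1)[OF \<beta>, of a \<tau> \<tau>] True
            unfolding set_integrable_def by (intro integrable_mult_right) auto
          show "norm (W \<tau> s) \<le> frac_kernel \<alpha> t \<tau> * M * (indicator {a..\<tau>} s *\<^sub>R frac_kernel \<beta> \<tau> s)" for s
            using True mult_left_mono[OF mult_left_mono[OF vM[of s] frac_kernel_nonneg[OF \<beta>, of \<tau> s]]
                frac_kernel_nonneg[OF \<alpha>, of t \<tau>]] frac_kernel_nonneg[OF \<alpha>, of t \<tau>] frac_kernel_nonneg[OF \<beta>, of \<tau> s] M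
            by (auto simp: W_def abs_mult mult_ac split: split_indicator)
        qed
        also have "\<dots> = frac_kernel \<alpha> t \<tau> * M * ((\<tau> - a) powr \<beta> / Gamma (\<beta> + 1))"
          using frac_kernel_lborel(2)[OF \<beta>, of a \<tau> \<tau>] True \<beta> by (simp add: set_lebesgue_integral_def)
        also have "\<dots> \<le> frac_kernel \<alpha> t \<tau> * M * ((t - a) powr \<beta> / Gamma (\<beta> + 1))"
          using True M \<alpha> \<beta> by (intro mult_left_mono divide_right_mono Gamma_real_nonneg mult_nonneg_nonneg frac_kernel_nonneg powr_mono2) auto
        finally show ?thesis using True by simp
      qed (simp add: W_eq)
      then have le: "(LINT s|lborel. norm (W \<tau> s)) \<le> norm (indicator {a..t} \<tau> *\<^sub>R (frac_kernel \<alpha> t \<tau> * ?c))" for \<tau>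
        unfolding real_norm_def[of "indicator {a..t} \<tau> *\<^sub>R (frac_kernel \<alpha> t \<tau> * ?c)"] by (rule order_trans[OF _ abs_ge_self])
      have "norm (LINT s|lborel. norm (W \<tau> s)) = (LINT s|lborel. norm (W \<tau> s))" for \<tau>
        by simp
      then show "AE \<tau> in lborel. norm (LINT s|lborel. norm (case_prod W (\<tau>, s))) \<le> norm (indicator {a..t} \<tau> *\<^sub>R (frac_kernel \<alpha> t \<tau> * ?c))"
        using le by (simp only: prod.case) simp
    qed
  qed
  then have "(LINT \<tau>|lborel. LINT s|lborel. W \<tau> s) = (LINT s|lborel. LINT \<tau>|lborel. W \<tau> s)"
    by (rule lborel_pair.Fubini_integral[symmetric])
  also have "\<dots> = (LINT s|lborel. indicator {a..t} s *\<^sub>R (frac_kernel (\<alpha> + \<beta>) t s * v s))"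
  proof (rule Bochner_Integration.integral_cong[OF refl])
    fix s
    have "(LINT \<tau>|lborel. W \<tau> s) = (LINT \<tau>|lborel. (indicator {a..t} s * v s) * (indicator {s..t} \<tau> *\<^sub>R (frac_kernel \<alpha> t \<tau> * frac_kernel \<beta> \<tau> s)))"
      by (intro Bochner_Integration.integral_cong) (auto simp: W_def split: split_indicator)
    also have "\<dots> = indicator {a..t} s *\<^sub>R (frac_kernel (\<alpha> + \<beta>) t s * v s)"
      using frac_kernel_convolution[OF \<alpha> \<beta>, of s t]
      by (auto simp: set_lebesgue_integral_def split: split_indicator)
    finally show "(LINT \<tau>|lborel. W \<tau> s) = indicator {a..t} s *\<^sub>R (frac_kernel (\<alpha> + \<beta>) t s * v s)" .
  qed
  finally show ?thesis
    using \<alpha> \<beta> by (simp add: inner left_frac_int_raw_lborel borel_measurable_left_frac_int_raw set_lebesgue_integral_def)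
qed

section \<open>Measurability and boundedness of the right-hand side\<close>

text \<open>A countable dense subset of \<open>K\<close> needs only one null set, and continuity in
  \<open>x\<close> extends the bound to all of \<open>K\<close>. Afterwards \<open>x\<close> may be
  replaced by a point that varies with \<open>t\<close>.\<close>

lemma AE_bounded_on:
  fixes f :: "'a::{metric_space, second_countable_topology} \<Rightarrow> 'b \<Rightarrow> 'c::real_normed_vector"
  assumes cont: "AE t in M. continuous_on K (\<lambda>x. f x t)"
    and bound: "\<And>x. x \<in> K \<Longrightarrow> AE t in M. norm (f x t) \<le> B"
  shows "AE t in M. \<forall>x\<in>K. norm (f x t) \<le> B"
proof -
  obtain T where T: "countable T" "T \<subseteq> K" "K \<subseteq> closure T" by (rule separable)
  have "AE t in M. \<forall>x\<in>T. norm (f x t) \<le> B"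
    using T bound by (intro AE_ball_countable') auto
  with cont show ?thesis
  proof eventually_elim
    case (elim t)
    show ?case
    proof
      fix x assume "x \<in> K"
      then obtain u where u: "\<And>n. u n \<in> T" "u \<longlonglongrightarrow> x"
        using T(3) by (metis closure_sequential subsetD)
      have "\<forall>n. u n \<in> K" using u(1) T(2) by blast
      then have "(\<lambda>n. f (u n) t) \<longlonglongrightarrow> f x t"
        using continuous_on_tendsto_compose[OF elim(1) u(2) \<open>x \<in> K\<close>] by simp
      then have "(\<lambda>n. norm (f (u n) t)) \<longlonglongrightarrow> norm (f x t)" by (rule tendsto_norm)
      then show "norm (f x t) \<le> B"
        by (rule LIMSEQ_le_const2) (use u elim(2) in auto)
    qed
  qed
qed

lemma borel_measurable_lebesgue_on_AE:
  fixes f g :: "real \<Rightarrow> 'b::euclidean_space"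
  assumes S: "S \<in> sets lebesgue" and f: "f \<in> borel_measurable (lebesgue_on S)"
    and AE: "AE t in lebesgue_on S. f t = g t"
  shows "g \<in> borel_measurable (lebesgue_on S)"
proof -
  have "AE t in lebesgue. (if t \<in> S then f t else 0) = (if t \<in> S then g t else 0)"
    using AE S by (subst (asm) AE_restrict_space_iff) auto
  from borel_measurable_AE[OF _ this] f show ?thesis
    by (simp add: borel_measurable_if[OF S])
qed

text \<open>Rounding the time inside \<open>q\<close> down to a grid leaves countably many values of
  \<open>q\<close>, and for each fixed value \<open>f\<close> is measurable in \<open>t\<close>.
  Continuity of \<open>f\<close> in its first argument then lets the mesh tend to 0.\<close>

lemma borel_measurable_caratheodory_compose:
  fixes f :: "real ^ 'm \<Rightarrow> real \<Rightarrow> real ^ 'm"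
  assumes cara: "caratheodory \<Omega> J f" and "I \<in> intervals_from a" "I \<subseteq> J" "J \<in> sets lebesgue"
    and q: "continuous_on I q" "q ` I \<subseteq> \<Omega>"
  shows "(\<lambda>t. f (q t) t) \<in> borel_measurable (lebesgue_on I)"
proof -
  have I: "is_interval I" "a \<in> I" "I \<subseteq> {a..}" using assms(2) by (auto simp: intervals_from_def)
  have I_leb: "I \<in> sets lebesgue" using real_interval_borel_measurable[OF I(1)] by simp
  \<comment> \<open>The mesh is 1/(n+1). Rounding down keeps \<open>p n t\<close> at most
    \<open>t\<close>, and the maximum with \<open>a\<close> stops it from leaving \<open>I\<close>
    on the left.\<close>
  define p where "p n t = max a (of_int \<lfloor>real (Suc n) * t\<rfloor> / real (Suc n))" for n t
  have p_le: "p n t \<le> t" if "t \<in> I" for n t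
    using that I by (auto simp: p_def field_simps)
  have p_I: "p n t \<in> I" if "t \<in> I" for n t
    by (rule mem_is_interval_1_I[OF I(1,2) that _ p_le[OF that]]) (simp add: p_def)
  have p_lim: "(\<lambda>n. p n t) \<longlonglongrightarrow> t" if "t \<in> I" for t
  proof (rule tendsto_sandwich)
    show "(\<lambda>n. t - inverse (real (Suc n))) \<longlonglongrightarrow> t"
      using tendsto_diff[OF tendsto_const LIMSEQ_inverse_real_of_nat, of t] by simp
    have "t - inverse (real (Suc n)) \<le> p n t" for n
    proof -
      have "real (Suc n) * t - 1 \<le> of_int \<lfloor>real (Suc n) * t\<rfloor>" by linarith
      then have "(real (Suc n) * t - 1) / real (Suc n) \<le> of_int \<lfloor>real (Suc n) * t\<rfloor> / real (Suc n)"
        by (intro divide_right_mono) auto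
      then show ?thesis by (simp add: p_def diff_divide_distrib inverse_eq_divide)
    qed
    then show "\<forall>\<^sub>F n in sequentially. t - inverse (real (Suc n)) \<le> p n t" by simp
    show "\<forall>\<^sub>F n in sequentially. p n t \<le> t" using p_le[OF that] by simp
  qed simp
  have q_lim: "(\<lambda>n. q (p n t)) \<longlonglongrightarrow> q t" if "t \<in> I" for t
    using continuous_on_tendsto_compose[OF q(1) p_lim[OF that] that] p_I[OF that] by simp
  have meas: "(\<lambda>t. f (q (p n t)) t) \<in> borel_measurable (lebesgue_on I)" for n
  proof -
    let ?y = "\<lambda>i. max a (of_int i / real (Suc n))"
    \<comment> \<open>Grid points outside \<open>I\<close> receive the value 0, since measurability
      of \<open>f x\<close> is known only for \<open>x\<close> in \<Omega>.\<close>
    define h where "h i t = (if ?y i \<in> I then f (q (?y i)) t else 0)" for i t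
    have "(\<lambda>t. h i t) \<in> borel_measurable (lebesgue_on I)" for i
    proof (cases "?y i \<in> I")
      case True
      then have "f (q (?y i)) \<in> borel_measurable (lebesgue_on J)"
        using cara q(2) by (auto simp: caratheodory_def)
      then have "f (q (?y i)) \<in> borel_measurable (lebesgue_on I)"
        using \<open>I \<subseteq> J\<close> by (rule measurable_restrict_mono)
      with True show ?thesis by (simp add: h_def[abs_def])
    qed (simp add: h_def)
    moreover have "(\<lambda>t. \<lfloor>real (Suc n) * t\<rfloor>) \<in> measurable (lebesgue_on I) (count_space UNIV)"
      by (intro measurable_compose[OF _ measurable_real_floor] borel_measurable_times borel_measurable_const
          measurable_restrict_space1 measurable_completion measurable_ident_sets) simp
    ultimately have hm: "(\<lambda>t. h \<lfloor>real (Suc n) * t\<rfloor> t) \<in> borel_measurable (lebesgue_on I)"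
      by (rule measurable_compose_countable)
    have hp: "h \<lfloor>real (Suc n) * t\<rfloor> t = f (q (p n t)) t" if "t \<in> space (lebesgue_on I)" for t
      using that p_I[of t n] by (simp add: h_def p_def)
    show ?thesis by (rule measurable_cong[THEN iffD1, OF hp hm])
  qed
  have "AE t in lebesgue_on J. continuous_on \<Omega> (\<lambda>x. f x t)"
    using cara by (simp add: caratheodory_def)
  then have "AE t in lebesgue_on I. continuous_on \<Omega> (\<lambda>x. f x t)"
    using \<open>I \<subseteq> J\<close> I_leb \<open>J \<in> sets lebesgue\<close> by (subst AE_restrict_space_iff, simp)
      (subst (asm) AE_restrict_space_iff, auto)
  then obtain N where N: "N \<in> null_sets (lebesgue_on I)" "\<And>t. t \<in> I - N \<Longrightarrow> continuous_on \<Omega> (\<lambda>x. f x t)"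
    by (elim AE_E3) auto
  have [measurable]: "N \<in> sets (lebesgue_on I)" using N(1) by auto
  \<comment> \<open>Zeroing on the null set where continuity in \<open>x\<close> may fail makes the
    convergence hold at every point of \<open>I\<close>.\<close>
  have "(\<lambda>t. if t \<in> N then 0 else f (q t) t) \<in> borel_measurable (lebesgue_on I)"
  proof (rule borel_measurable_LIMSEQ_metric)
    show "(\<lambda>t. if t \<in> N then 0 else f (q (p n t)) t) \<in> borel_measurable (lebesgue_on I)" for n
      using meas[of n] by measurable
    fix t assume "t \<in> space (lebesgue_on I)"
    then have "t \<in> I" by simp
    then have "\<forall>n. q (p n t) \<in> \<Omega>" "q t \<in> \<Omega>" using q(2) p_I by auto
    with \<open>t \<in> I\<close> show "(\<lambda>n. if t \<in> N then 0 else f (q (p n t)) t) \<longlonglongrightarrow> (if t \<in> N then 0 else f (q t) t)"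
      using continuous_on_tendsto_compose[OF N(2) q_lim[of t], of t] by simp
  qed
  moreover have "AE t in lebesgue_on I. (if t \<in> N then 0 else f (q t) t) = f (q t) t"
    using AE_not_in[OF N(1)] by eventually_elim simp
  ultimately show ?thesis
    by (rule borel_measurable_lebesgue_on_AE[OF I_leb])
qed

text \<open>Being Borel and bounded on the whole line, \<open>v\<close> enters the kernel estimates
  and Fubini without exceptional points; agreement with \<open>g\<close> is asked only on [a,b],
  since fractional integrals based at \<open>a\<close> up to time \<open>b\<close> see nothing
  else.\<close>

definition bounded_borel_version :: "real \<Rightarrow> real \<Rightarrow> (real \<Rightarrow> real) \<Rightarrow> (real \<Rightarrow> real) \<Rightarrow> real \<Rightarrow> bool" where
  "bounded_borel_version a b g v M \<longleftrightarrow> v \<in> borel_measurable borel \<and> (\<forall>t. \<bar>v t\<bar> \<le> M) \<and>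
    (AE t in lebesgue. t \<in> {a..b} \<longrightarrow> g t = v t)"

lemma bounded_borel_versionD:
  assumes "bounded_borel_version a b g v M"
  shows "v \<in> borel_measurable borel" "\<bar>v t\<bar> \<le> M" "AE t in lebesgue. t \<in> {a..b} \<longrightarrow> g t = v t"
  using assms by (auto simp: bounded_borel_version_def)

lemma ex_bounded_borel_version:
  assumes g: "g \<in> borel_measurable (lebesgue_on {a..b})" and M: "AE t in lebesgue_on {a..b}. \<bar>g t\<bar> \<le> M"
  shows "\<exists>v M. bounded_borel_version a b g v M"
proof -
  have "(\<lambda>t. if t \<in> {a..b} then g t else 0) \<in> borel_measurable lebesgue"
    using g by (subst borel_measurable_if) auto
  then obtain w where [measurable]: "w \<in> borel_measurable borel"
    and w: "AE t in lborel. (if t \<in> {a..b} then g t else 0) = w t"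
    by (auto dest!: completion_ex_borel_measurable_real)
  \<comment> \<open>Within [a,b] the truncation changes \<open>w\<close> only on a null set, because
    |g| \<le> M almost everywhere there. Using |M| keeps the two bounds in order for negative
    \<open>M\<close>, which can occur if [a,b] is null.\<close>
  define v where "v t = max (- \<bar>M\<bar>) (min \<bar>M\<bar> (w t))" for t
  have "v \<in> borel_measurable borel" unfolding v_def by measurable
  moreover have "\<bar>v t\<bar> \<le> \<bar>M\<bar>" for t by (auto simp: v_def)
  moreover have "AE t in lebesgue. t \<in> {a..b} \<longrightarrow> \<bar>g t\<bar> \<le> M"
    using M by (subst (asm) AE_restrict_space_iff) auto
  with AE_completion[OF w] have "AE t in lebesgue. t \<in> {a..b} \<longrightarrow> g t = v t"
    by eventually_elim (auto simp: v_def)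
  ultimately show ?thesis unfolding bounded_borel_version_def by blast
qed

section \<open>Intervals starting at a point\<close>

lemma intervals_fromD:
  assumes "I \<in> intervals_from a"
  shows "a \<in> I" "I \<in> sets borel" "\<And>t. t \<in> I \<Longrightarrow> a \<le> t" "\<And>b. b \<in> I \<Longrightarrow> {a..b} \<subseteq> I"
proof -
  have I: "is_interval I" "a \<in> I" "I \<subseteq> {a..}" using assms by (auto simp: intervals_from_def)
  show "I \<in> sets borel" using real_interval_borel_measurable[OF I(1)] .
  show "a \<in> I" "\<And>t. t \<in> I \<Longrightarrow> a \<le> t" using I by auto
  show "{a..b} \<subseteq> I" if "b \<in> I" for b using mem_is_interval_1_I[OF I(1,2) that] by auto
qed

text \<open>Countably many rational right ends \<open>b\<close> exhaust \<open>I\<close> up to its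
  end points. If \<open>I\<close> has a maximum, it is \<open>Sup I\<close>, a single point that is
  discarded together with \<open>a\<close>.\<close>

lemma AE_intervals_fromI:
  assumes I: "I \<in> intervals_from a"
    and P: "\<And>b. b \<in> I \<Longrightarrow> AE t in lebesgue. t \<in> {a<..<b} \<longrightarrow> P t"
  shows "AE t in lebesgue_on I. P t"
proof -
  note ID = intervals_fromD[OF I]
  have "AE t in lebesgue. \<forall>b\<in>I \<inter> \<rat>. t \<in> {a<..<b} \<longrightarrow> P t"
    using P by (intro AE_ball_countable') (auto simp: countable_rat)
  moreover have "AE t in lebesgue. t \<noteq> a" "AE t in lebesgue. t \<noteq> Sup I"
    by (intro AE_completion AE_lborel_singleton)+
  ultimately have "AE t in lebesgue. t \<in> I \<longrightarrow> P t"
  proof eventually_elim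
    case (elim t)
    show ?case
    proof
      assume t: "t \<in> I"
      obtain c where c: "c \<in> I" "t < c"
      proof (rule ccontr)
        assume "\<not> thesis"
        then have "Sup I = t" using that t by (intro cSup_eq_maximum) (auto simp: not_less[symmetric])
        with elim show False by simp
      qed
      obtain r where r: "r \<in> \<rat>" "t < r" "r < c" using Rats_dense_in_real[OF c(2)] by blast
      then have "r \<in> I" using ID(4)[OF c(1)] ID(3)[OF t] by auto
      moreover have "a < t" using ID(3)[OF t] elim by auto
      ultimately show "P t" using elim(1) r by auto
    qed
  qed
  then show ?thesis using ID(2) by (subst AE_restrict_space_iff) auto
qed

text \<open>A point with some larger \<open>b\<close> in \<open>I\<close> locally sees only [a,b]; a
  point without one is the maximum \<open>t\<close>, and then \<open>I = {a..t}\<close>.\<close>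

lemma continuous_on_intervals_fromI:
  fixes F :: "real \<Rightarrow> 'b::topological_space"
  assumes I: "I \<in> intervals_from a" and F: "\<And>b. b \<in> I \<Longrightarrow> continuous_on {a..b} F"
  shows "continuous_on I F"
  unfolding continuous_on_def
proof
  fix t assume t: "t \<in> I"
  note ID = intervals_fromD[OF I]
  show "(F \<longlongrightarrow> F t) (at t within I)"
  proof (cases "\<exists>b\<in>I. t < b")
    case True
    then obtain b where b: "b \<in> I" "t < b" by blast
    have "at t within I = at t within {a..b}"
      by (rule at_within_nhd[of _ "{..<b}"]) (use b ID(3) ID(4)[OF b(1)] in auto)
    then show ?thesis using F[OF b(1)] b ID(3)[OF t] by (simp add: continuous_on_def)
  next
    case False
    then have "I = {a..t}" using ID(3) ID(4)[OF t] by force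
    then show ?thesis using F[OF t] ID(3)[OF t] by (simp add: continuous_on_def)
  qed
qed

text \<open>Continuous functions that differ at a point of a nondegenerate interval differ on a
  subinterval of positive length. Hence whatever representative the choice operator picks, its
  values on \<open>I\<close> are those of \<open>g\<close>.\<close>

lemma continuous_version_eq:
  assumes I: "I \<in> intervals_from a" and g: "continuous_on I g" and t: "t \<in> I"
  shows "continuous_version I g t = g t"
proof -
  note ID = intervals_fromD[OF I]
  define h where "h = (SOME h. continuous_on I h \<and> (AE t in lebesgue_on I. g t = h t))"
  have ex: "\<exists>h. continuous_on I h \<and> (AE t in lebesgue_on I. g t = h t)" using g by auto
  then have "continuous_on I h \<and> (AE t in lebesgue_on I. g t = h t)"
    unfolding h_def by (rule someI_ex)
  then have h: "continuous_on I h" "AE t in lebesgue_on I. g t = h t" by auto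
  have "h t = g t"
  proof (rule ccontr)
    assume ne: "h t \<noteq> g t"
    have "continuous_on I (\<lambda>s. h s - g s)" using g h(1) by (intro continuous_intros)
    then obtain d where d: "d > 0" "\<And>s. s \<in> I \<Longrightarrow> dist s t < d \<Longrightarrow> dist (h s - g s) (h t - g t) < dist (h t - g t) 0"
      using t ne unfolding continuous_on_iff by (metis diff_0_right dist_nz eq_iff_diff_eq_0)
    \<comment> \<open>\<open>I\<close> is larger than {a}, so a second point exists; it gives a side
      of \<open>t\<close> on which the interval continues.\<close>
    obtain c where c: "c \<in> I" "c \<noteq> t" using I t unfolding intervals_from_def by blast
    define u where "u = max (min c t) (t - d)"
    define v where "v = min (max c t) (t + d)"
    have "u < v" using c d(1) by (auto simp: u_def v_def)
    have uv: "{u<..<v} \<subseteq> I"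
      using ID(3)[OF c(1)] ID(3)[OF t] ID(4)[OF c(1)] ID(4)[OF t] by (auto simp: u_def v_def subset_eq max_def min_def split: if_splits)
    have ne': "g s \<noteq> h s" if "s \<in> {u<..<v}" for s
    proof -
      have "dist s t < d" using that by (auto simp: u_def v_def dist_real_def)
      with d(2)[of s] uv that show ?thesis by auto
    qed
    have "AE s in lebesgue. s \<in> I \<longrightarrow> g s = h s"
      using h(2) ID(2) by (subst (asm) AE_restrict_space_iff) auto
    then have "AE s in lebesgue. s \<notin> {u<..<v}"
      by eventually_elim (use uv ne' in blast)
    then have "negligible {u<..<v}"
      unfolding negligible_iff_null_sets by (subst AE_iff_null_sets) auto
    then show False using \<open>u < v\<close> by (simp add: open_not_negligible)
  qed
  then show ?thesis using ex by (simp add: continuous_version_def h_def)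
qed

section \<open>The scalar Caputo equation\<close>

lemma left_frac_int_raw_cong:
  assumes "a \<le> t" and "\<And>s. s \<in> {a..t} \<Longrightarrow> u s = v s"
  shows "left_frac_int_raw a \<beta> u t = left_frac_int_raw a \<beta> v t"
  using assms by (auto simp: left_frac_int_raw_def set_lebesgue_integral_def
      intro!: Bochner_Integration.integral_cong split: split_indicator)

lemma frac_kernel_mult_AE:
  assumes "bounded_borel_version a b g v M" "t \<le> b"
  shows "AE \<tau> in lebesgue. indicat_real {a..t} \<tau> *\<^sub>R (frac_kernel \<beta> t \<tau> * v \<tau>)
    = indicat_real {a..t} \<tau> *\<^sub>R (frac_kernel \<beta> t \<tau> * g \<tau>)"
  using bounded_borel_versionD(3)[OF assms(1)]
  by eventually_elim (use assms(2) in \<open>auto split: split_indicator\<close>)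

lemma borel_measurable_frac_kernel_mult:
  assumes v: "bounded_borel_version a b g v M" and "t \<le> b"
  shows "(\<lambda>\<tau>. indicat_real {a..t} \<tau> *\<^sub>R (frac_kernel \<beta> t \<tau> * g \<tau>)) \<in> borel_measurable lebesgue"
proof (rule borel_measurable_AE[OF _ frac_kernel_mult_AE[OF assms]])
  have [measurable]: "v \<in> borel_measurable borel" using bounded_borel_versionD(1)[OF v] .
  have "(\<lambda>\<tau>. indicat_real {a..t} \<tau> *\<^sub>R (frac_kernel \<beta> t \<tau> * v \<tau>)) \<in> borel_measurable lborel" by measurable
  then show "(\<lambda>\<tau>. indicat_real {a..t} \<tau> *\<^sub>R (frac_kernel \<beta> t \<tau> * v \<tau>)) \<in> borel_measurable lebesgue"
    by (rule measurable_completion)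
qed

lemma left_frac_int_raw_version:
  assumes v: "bounded_borel_version a b g v M" and "t \<le> b" "0 < \<beta>"
  shows "left_frac_int_raw a \<beta> g t = left_frac_int_raw a \<beta> v t"
proof -
  have [measurable]: "v \<in> borel_measurable borel" using bounded_borel_versionD(1)[OF v] .
  have "(\<lambda>\<tau>. indicat_real {a..t} \<tau> *\<^sub>R (frac_kernel \<beta> t \<tau> * v \<tau>)) \<in> borel_measurable lborel" by measurable
  then have "(\<lambda>\<tau>. indicat_real {a..t} \<tau> *\<^sub>R (frac_kernel \<beta> t \<tau> * v \<tau>)) \<in> borel_measurable lebesgue"
    by (rule measurable_completion)
  then show ?thesis
    using assms(3) integral_cong_AE[OF borel_measurable_frac_kernel_mult[OF v assms(2)] _
      AE_symmetric[OF frac_kernel_mult_AE[OF v assms(2)]]]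
    by (simp add: left_frac_int_raw_def set_lebesgue_integral_def)
qed

text \<open>Equality of integrals alone does not give integrability, since Bochner integrals of
  nonintegrable functions are 0 by convention; it is required for taking components of the vector
  integral.\<close>

lemma integrable_frac_kernel_mult:
  assumes v: "bounded_borel_version a b g v M" and "t \<le> b" "a \<le> t" "0 < \<beta>"
  shows "integrable lebesgue (\<lambda>\<tau>. indicat_real {a..t} \<tau> *\<^sub>R (frac_kernel \<beta> t \<tau> * g \<tau>))"
proof (rule integrable_cong_AE_imp[OF _ borel_measurable_frac_kernel_mult[OF v assms(2)]])
  note [measurable] = bounded_borel_versionD(1)[OF v]
  have "integrable lborel (\<lambda>\<tau>. indicat_real {a..t} \<tau> *\<^sub>R (frac_kernel \<beta> t \<tau> * v \<tau>))"
    using set_integrable_frac_kernel_mult[OF bounded_borel_versionD(1,2)[OF v] assms(4,3)]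
    by (simp add: set_integrable_def)
  then show "integrable lebesgue (\<lambda>\<tau>. indicat_real {a..t} \<tau> *\<^sub>R (frac_kernel \<beta> t \<tau> * v \<tau>))"
    by (subst integrable_completion) auto
  show "AE \<tau> in lebesgue. indicat_real {a..t} \<tau> *\<^sub>R (frac_kernel \<beta> t \<tau> * v \<tau>) =
      indicat_real {a..t} \<tau> *\<^sub>R (frac_kernel \<beta> t \<tau> * g \<tau>)"
    by (rule frac_kernel_mult_AE[OF v assms(2)])
qed

lemma continuous_on_bounded_borel_version:
  assumes "continuous_on {a..b} u"
  shows "\<exists>M. bounded_borel_version a b u (\<lambda>s. if s \<in> {a..b} then u s else 0) M"
proof -
  have "bounded (u ` {a..b})" using assms by (intro compact_imp_bounded compact_continuous_image) auto
  then obtain M where M: "M > 0" "\<And>s. s \<in> {a..b} \<Longrightarrow> \<bar>u s\<bar> \<le> M" by (auto simp: bounded_pos)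
  moreover have "(\<lambda>s. if s \<in> {a..b} then u s else 0) \<in> borel_measurable borel"
    using assms by (intro borel_measurable_continuous_on_if) auto
  ultimately show ?thesis unfolding bounded_borel_version_def by (intro exI[of _ M]) auto
qed

text \<open>The kernel of order one is 1 except at \<tau> = t, where 0 powr 0 = 0; this point is
  removed as a negligible set.\<close>

lemma has_integral_left_frac_int_raw_one:
  assumes v: "v \<in> borel_measurable borel" "\<And>\<tau>. \<bar>v \<tau>\<bar> \<le> M" and "a \<le> t"
  shows "(v has_integral left_frac_int_raw a 1 v t) {a..t}"
proof (rule has_integral_spike[of "{t}"])
  have "set_integrable lborel {a..t} (\<lambda>\<tau>. frac_kernel 1 t \<tau> * v \<tau>)"
    by (rule set_integrable_frac_kernel_mult[OF v]) (use assms in auto)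
  from set_borel_integral_eq_integral[OF this]
  show "((\<lambda>\<tau>. frac_kernel 1 t \<tau> * v \<tau>) has_integral left_frac_int_raw a 1 v t) {a..t}"
    by (simp add: left_frac_int_raw_lborel v has_integral_iff)
qed (auto simp: frac_kernel_def)

section \<open>Order one: primitives and local absolute continuity\<close>

lemma abs_continuous_on_lipschitz:
  assumes "\<And>s t. c \<le> s \<Longrightarrow> s \<le> t \<Longrightarrow> t \<le> d \<Longrightarrow> \<bar>F t - F s\<bar> \<le> L * (t - s)"
  shows "abs_continuous_on c d F"
  unfolding abs_continuous_on_def
proof (intro allI impI)
  fix \<epsilon> :: real assume "\<epsilon> > 0"
  show "\<exists>\<delta>>0. \<forall>(n::nat) (u::nat \<Rightarrow> real) (v::nat \<Rightarrow> real).
      (\<forall>k<n. c \<le> u k \<and> u k \<le> v k \<and> v k \<le> d) \<and>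
      (\<forall>j<n. \<forall>k<n. j \<noteq> k \<longrightarrow> {u j<..<v j} \<inter> {u k<..<v k} = {}) \<and>
      (\<Sum>k<n. v k - u k) < \<delta>
      \<longrightarrow> (\<Sum>k<n. \<bar>F (v k) - F (u k)\<bar>) < \<epsilon>"
  proof (intro exI[of _ "\<epsilon> / (\<bar>L\<bar> + 1)"] conjI allI impI)
    show "\<epsilon> / (\<bar>L\<bar> + 1) > 0" using \<open>\<epsilon> > 0\<close> by simp
    fix n :: nat and u v :: "nat \<Rightarrow> real"
    assume A: "(\<forall>k<n. c \<le> u k \<and> u k \<le> v k \<and> v k \<le> d) \<and>
      (\<forall>j<n. \<forall>k<n. j \<noteq> k \<longrightarrow> {u j<..<v j} \<inter> {u k<..<v k} = {}) \<and>
      (\<Sum>k<n. v k - u k) < \<epsilon> / (\<bar>L\<bar> + 1)"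
    have "(\<Sum>k<n. \<bar>F (v k) - F (u k)\<bar>) \<le> (\<Sum>k<n. (\<bar>L\<bar> + 1) * (v k - u k))"
    proof (rule sum_mono)
      fix k assume "k \<in> {..<n}"
      then have k: "c \<le> u k" "u k \<le> v k" "v k \<le> d" using A by auto
      have "L * (v k - u k) \<le> (\<bar>L\<bar> + 1) * (v k - u k)" using k by (intro mult_right_mono) auto
      with assms[OF k] show "\<bar>F (v k) - F (u k)\<bar> \<le> (\<bar>L\<bar> + 1) * (v k - u k)" by linarith
    qed
    also have "\<dots> = (\<bar>L\<bar> + 1) * (\<Sum>k<n. v k - u k)" by (simp add: sum_distrib_left)
    also have "\<dots> < \<epsilon>" using A by (simp add: pos_less_divide_eq mult.commute)
    finally show "(\<Sum>k<n. \<bar>F (v k) - F (u k)\<bar>) < \<epsilon>" .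
  qed
qed

text \<open>Local boundedness makes the primitive Lipschitz on compact subintervals: this is the
  Hoelder estimate with exponent 1. In the other direction \<open>h a = 0\<close> fixes the constant
  of integration.\<close>

lemma AC_loc_iff_left_frac_int_raw_one:
  assumes I: "I \<in> intervals_from a" and g: "\<And>b. b \<in> I \<Longrightarrow> \<exists>v M. bounded_borel_version a b g v M"
    and h: "h a = 0"
  shows "h \<in> AC_loc I \<and> (AE t in lebesgue_on I. (h has_real_derivative g t) (at t within I)) \<longleftrightarrow>
    (\<forall>t\<in>I. h t = left_frac_int_raw a 1 g t)"
proof (intro iffI ballI conjI)
  note ID = intervals_fromD[OF I]
  fix t assume A: "h \<in> AC_loc I \<and> (AE t in lebesgue_on I. (h has_real_derivative g t) (at t within I))" and t: "t \<in> I"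
  obtain v M where v: "bounded_borel_version a t g v M" using g[OF t] by blast
  have "AE s in lebesgue. s \<in> I \<longrightarrow> (h has_real_derivative g s) (at s within I)"
    using A ID(2) by (subst (asm) AE_restrict_space_iff) auto
  with bounded_borel_versionD(3)[OF v]
  have "AE s in lebesgue. s \<in> {a..t} \<longrightarrow> (h has_real_derivative v s) (at s within {a..t})"
    by eventually_elim (use ID(4)[OF t] in \<open>auto intro: has_field_derivative_subset\<close>)
  then have "negligible {s. \<not> (s \<in> {a..t} \<longrightarrow> (h has_real_derivative v s) (at s within {a..t}))}"
    by (simp add: completion.AE_iff_null_sets negligible_iff_null_sets)
  from has_integral_abs_continuous_on[OF ID(3)[OF t] _ this, of h v]
  have "(v has_integral h t - h a) {a..t}"
    using A ID(4)[OF t] by (auto simp: AC_loc_def has_real_derivative_iff_has_vector_derivative)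
  with has_integral_left_frac_int_raw_one[OF bounded_borel_versionD(1,2)[OF v] ID(3)[OF t]]
  show "h t = left_frac_int_raw a 1 g t"
    using h left_frac_int_raw_version[OF v, of t 1] by (auto dest: has_integral_unique)
next
  note ID = intervals_fromD[OF I]
  assume h: "\<forall>t\<in>I. h t = left_frac_int_raw a 1 g t"
  show "h \<in> AC_loc I"
    unfolding AC_loc_def
  proof (intro CollectI allI impI)
    fix c d assume cd: "{c..d} \<subseteq> I"
    show "abs_continuous_on c d h"
    proof (cases "c \<le> d")
      case True
      then have d: "d \<in> I" "c \<in> I" using cd by auto
      obtain v M where v: "bounded_borel_version a d g v M" using g[OF d(1)] by blast
      have eq: "h t = left_frac_int_raw a 1 v t" if "c \<le> t" "t \<le> d" for t
        using h that cd left_frac_int_raw_version[OF v, of t 1] by auto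
      show ?thesis
      proof (rule abs_continuous_on_lipschitz)
        fix s t assume st: "c \<le> s" "s \<le> t" "t \<le> d"
        then show "\<bar>h t - h s\<bar> \<le> 2 * M / Gamma (1 + 1) * (t - s)"
          using left_frac_int_raw_holder[OF bounded_borel_versionD(1,2)[OF v], of 1 a s t] ID(3)[OF d(2)]
          by (simp add: eq)
      qed
    qed (intro abs_continuous_on_lipschitz, simp)
  qed
  show "AE t in lebesgue_on I. (h has_real_derivative g t) (at t within I)"
  proof (rule AE_intervals_fromI[OF I])
    fix b assume b: "b \<in> I"
    obtain v M where v: "bounded_borel_version a b g v M" using g[OF b] by blast
    note vh = has_integral_left_frac_int_raw_one[OF bounded_borel_versionD(1,2)[OF v], where a = a]
    obtain N where N: "negligible N"
      "\<And>x. x \<in> {a<..<b} - N \<Longrightarrow> ((\<lambda>t. integral {a..t} v) has_real_derivative v x) (at x)"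
      using lebesgue_differentiation_real[OF has_integral_integrable[OF vh[OF ID(3)[OF b]]]] by blast
    have "AE t in lebesgue. t \<notin> N" using N(1) by (simp add: negligible_iff_null_sets AE_not_in)
    with bounded_borel_versionD(3)[OF v]
    show "AE t in lebesgue. t \<in> {a<..<b} \<longrightarrow> (h has_real_derivative g t) (at t within I)"
    proof eventually_elim
      case (elim t)
      show ?case
      proof
        assume t: "t \<in> {a<..<b}"
        have "integral {a..s} v = h s" if "s \<in> {a<..<b}" for s
        proof -
          have "s \<in> I" using that ID(4)[OF b] by auto
          then show ?thesis
            using that h vh[of s] left_frac_int_raw_version[OF v, of s 1] by (auto simp: has_integral_iff)
        qed
        from has_field_derivative_transform_within_open[OF N(2) _ t this]
        have "(h has_real_derivative v t) (at t)" using t elim by auto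
        then show "(h has_real_derivative g t) (at t within I)"
          using t elim by (auto intro: has_field_derivative_at_within)
      qed
    qed
  qed
qed

section \<open>Complementary orders and injectivity\<close>

text \<open>For \<alpha> = 1 the complementary order is 0, which the semigroup law for positive
  orders does not cover; there the integral is the identity by definition.\<close>

lemma left_frac_int_raw_complementary:
  assumes v: "v \<in> borel_measurable borel" "\<And>\<tau>. \<bar>v \<tau>\<bar> \<le> M" and \<alpha>: "0 < \<alpha>" "\<alpha> \<le> 1" and t: "a \<le> t"
  shows "left_frac_int_raw a (1 - \<alpha>) (left_frac_int_raw a \<alpha> v) t = left_frac_int_raw a 1 v t"
    and "left_frac_int_raw a \<alpha> (left_frac_int_raw a (1 - \<alpha>) v) t = left_frac_int_raw a 1 v t"
proof -
  have 0: "left_frac_int_raw a 0 u = u" for u by (simp add: left_frac_int_raw_def fun_eq_iff)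
  show "left_frac_int_raw a (1 - \<alpha>) (left_frac_int_raw a \<alpha> v) t = left_frac_int_raw a 1 v t"
  proof (cases "\<alpha> = 1")
    case False
    with left_frac_int_raw_add_order[OF v, of "1 - \<alpha>" \<alpha> a t] \<alpha> t show ?thesis by simp
  qed (simp add: 0)
  show "left_frac_int_raw a \<alpha> (left_frac_int_raw a (1 - \<alpha>) v) t = left_frac_int_raw a 1 v t"
  proof (cases "\<alpha> = 1")
    case False
    with left_frac_int_raw_add_order[OF v, of \<alpha> "1 - \<alpha>" a t] \<alpha> t show ?thesis by simp
  qed (simp add: 0)
qed

lemma left_frac_int_raw_diff:
  assumes u: "u \<in> borel_measurable borel" "\<And>\<tau>. \<bar>u \<tau>\<bar> \<le> L"
    and v: "v \<in> borel_measurable borel" "\<And>\<tau>. \<bar>v \<tau>\<bar> \<le> M" and "0 \<le> \<beta>" "a \<le> t"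
  shows "left_frac_int_raw a \<beta> (\<lambda>s. u s - v s) t = left_frac_int_raw a \<beta> u t - left_frac_int_raw a \<beta> v t"
proof (cases "\<beta> = 0")
  case False
  then show ?thesis
    using set_integrable_frac_kernel_mult[OF u, of \<beta> a t t] set_integrable_frac_kernel_mult[OF v, of \<beta> a t t] assms(5,6)
    by (simp add: left_frac_int_raw_lborel u v borel_measurable_diff right_diff_distrib)
qed (simp add: left_frac_int_raw_def)

text \<open>The complementary integral turns the hypothesis into a vanishing primitive, which is then differentiated.\<close>

lemma left_frac_int_raw_eq_0:
  assumes z: "continuous_on {a..b} z" and "a < b" and \<alpha>: "0 < \<alpha>" "\<alpha> \<le> 1"
    and 0: "\<And>t. t \<in> {a..b} \<Longrightarrow> left_frac_int_raw a (1 - \<alpha>) z t = 0" and t: "t \<in> {a..b}"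
  shows "z t = 0"
proof -
  define z' where "z' = (\<lambda>s. if s \<in> {a..b} then z s else 0)"
  obtain M where "bounded_borel_version a b z z' M"
    using continuous_on_bounded_borel_version[OF z] by (auto simp: z'_def)
  note z' = bounded_borel_versionD(1,2)[OF this]
  have "integral {a..s} z' = 0" if s: "s \<in> {a..b}" for s
  proof -
    have "left_frac_int_raw a (1 - \<alpha>) z' r = 0" if "r \<in> {a..s}" for r
      using 0[of r] left_frac_int_raw_cong[of a r z' z "1 - \<alpha>"] that s by (auto simp: z'_def)
    then have "left_frac_int_raw a \<alpha> (left_frac_int_raw a (1 - \<alpha>) z') s = left_frac_int_raw a \<alpha> (\<lambda>_. 0) s"
      using s by (intro left_frac_int_raw_cong) auto
    also have "\<dots> = 0" by (simp add: left_frac_int_raw_def set_lebesgue_integral_def)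
    finally show ?thesis
      using left_frac_int_raw_complementary(2)[OF z' \<alpha>] has_integral_left_frac_int_raw_one[OF z', of a s] s
      by (auto simp: has_integral_iff)
  qed
  \<comment> \<open>The primitive vanishes on [a,b], so 0 is a derivative within [a,b]; such
    derivatives are unique even at the end points because a < b.\<close>
  then have "((\<lambda>s. integral {a..s} z') has_vector_derivative 0) (at t within cbox a b)"
    using t by (intro has_vector_derivative_transform[OF _ _ has_vector_derivative_const[of "0::real"]]) auto
  moreover have "continuous_on {a..b} z'" by (rule continuous_on_eq[OF z]) (simp add: z'_def)
  then have "((\<lambda>s. integral {a..s} z') has_vector_derivative z' t) (at t within cbox a b)"
    using integral_has_vector_derivative[of a b z' t] t by simp
  ultimately have "z' t = 0"
    using vector_derivative_unique_within_closed_interval[OF \<open>a < b\<close>, of t] t by auto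
  then show ?thesis using t by (simp add: z'_def)
qed

lemma continuous_on_left_frac_int_raw_version:
  assumes I: "I \<in> intervals_from a" and g: "\<And>b. b \<in> I \<Longrightarrow> \<exists>v M. bounded_borel_version a b g v M"
    and \<beta>: "0 < \<beta>" "\<beta> \<le> 1"
  shows "continuous_on I (left_frac_int_raw a \<beta> g)"
proof (rule continuous_on_intervals_fromI[OF I])
  fix b assume "b \<in> I"
  then obtain v M where v: "bounded_borel_version a b g v M" using g by blast
  have "continuous_on {a..b} (left_frac_int_raw a \<beta> v)"
    using continuous_on_left_frac_int_raw[OF bounded_borel_versionD(1,2)[OF v] \<beta>] by (rule continuous_on_subset) auto
  then show "continuous_on {a..b} (left_frac_int_raw a \<beta> g)"
    by (rule continuous_on_eq) (simp add: left_frac_int_raw_version[OF v _ \<beta>(1)])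
qed

text \<open>Forward, this is the semigroup law. Conversely, \<open>w\<close> and the integral of
  order \<alpha> of \<open>g\<close> have equal integrals of order 1 - \<alpha>; their difference is
  continuous, so injectivity applies.\<close>

lemma left_frac_int_raw_inverse_iff:
  assumes I: "I \<in> intervals_from a" and g: "\<And>b. b \<in> I \<Longrightarrow> \<exists>v M. bounded_borel_version a b g v M"
    and \<alpha>: "0 < \<alpha>" "\<alpha> \<le> 1" and w: "continuous_on I w" "w a = 0"
  shows "(\<forall>t\<in>I. w t = left_frac_int_raw a \<alpha> g t) \<longleftrightarrow> (\<forall>t\<in>I. left_frac_int_raw a (1 - \<alpha>) w t = left_frac_int_raw a 1 g t)"
proof -
  note ID = intervals_fromD[OF I]
  let ?y = "left_frac_int_raw a \<alpha> g"
  have y: "left_frac_int_raw a (1 - \<alpha>) ?y t = left_frac_int_raw a 1 g t" if t: "t \<in> I" for t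
  proof -
    obtain v M where v: "bounded_borel_version a t g v M" using g[OF t] by blast
    have "left_frac_int_raw a (1 - \<alpha>) ?y t = left_frac_int_raw a (1 - \<alpha>) (left_frac_int_raw a \<alpha> v) t"
      by (rule left_frac_int_raw_cong[OF ID(3)[OF t]]) (simp add: left_frac_int_raw_version[OF v _ \<alpha>(1)])
    also have "\<dots> = left_frac_int_raw a 1 v t"
      using left_frac_int_raw_complementary(1)[OF bounded_borel_versionD(1,2)[OF v] \<alpha> ID(3)[OF t]] .
    finally show ?thesis using left_frac_int_raw_version[OF v, of t 1] by simp
  qed
  have y_cont: "continuous_on I ?y" by (rule continuous_on_left_frac_int_raw_version[OF I g \<alpha>])
  show ?thesis
  proof (intro iffI ballI)
    fix t assume "\<forall>t\<in>I. w t = ?y t" and t: "t \<in> I"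
    then have "left_frac_int_raw a (1 - \<alpha>) w t = left_frac_int_raw a (1 - \<alpha>) ?y t"
      using ID(3)[OF t] ID(4)[OF t] by (intro left_frac_int_raw_cong) auto
    then show "left_frac_int_raw a (1 - \<alpha>) w t = left_frac_int_raw a 1 g t" using y[OF t] by simp
  next
    fix b assume A: "\<forall>t\<in>I. left_frac_int_raw a (1 - \<alpha>) w t = left_frac_int_raw a 1 g t" and b: "b \<in> I"
    show "w b = ?y b"
    proof (cases "a < b")
      case True
      have wc: "continuous_on {a..b} w" and yc: "continuous_on {a..b} ?y"
        using w(1) y_cont ID(4)[OF b] by (auto intro: continuous_on_subset)
      \<comment> \<open>Cutting off outside [a,b] turns both continuous functions into bounded Borel
        functions on the line, the form in which linearity of the integral is available.\<close>
      let ?r = "\<lambda>u s. if s \<in> {a..b} then u s else 0 :: real"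
      obtain L M where "bounded_borel_version a b w (?r w) L" "bounded_borel_version a b ?y (?r ?y) M"
        using continuous_on_bounded_borel_version[OF wc] continuous_on_bounded_borel_version[OF yc] by blast
      note LM = bounded_borel_versionD(1,2)[OF this(1)] bounded_borel_versionD(1,2)[OF this(2)]
      have "left_frac_int_raw a (1 - \<alpha>) (\<lambda>s. w s - ?y s) t = 0" if t: "t \<in> {a..b}" for t
      proof -
        have "left_frac_int_raw a (1 - \<alpha>) (\<lambda>s. w s - ?y s) t = left_frac_int_raw a (1 - \<alpha>) (\<lambda>s. ?r w s - ?r ?y s) t"
          using t by (intro left_frac_int_raw_cong) auto
        also have "\<dots> = left_frac_int_raw a (1 - \<alpha>) (?r w) t - left_frac_int_raw a (1 - \<alpha>) (?r ?y) t"
          using t \<alpha> by (intro left_frac_int_raw_diff[OF LM]) auto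
        also have "left_frac_int_raw a (1 - \<alpha>) (?r w) t = left_frac_int_raw a (1 - \<alpha>) w t"
          using t by (intro left_frac_int_raw_cong) auto
        also have "left_frac_int_raw a (1 - \<alpha>) (?r ?y) t = left_frac_int_raw a (1 - \<alpha>) ?y t"
          using t by (intro left_frac_int_raw_cong) auto
        finally show ?thesis using A y ID(4)[OF b] t by auto
      qed
      from left_frac_int_raw_eq_0[OF continuous_on_diff[OF wc yc] True \<alpha> this, of b] show ?thesis
        using True by simp
    next
      case False
      then have "b = a" using ID(3)[OF b] by simp
      moreover have "?y a = 0"
      proof -
        obtain v M where v: "bounded_borel_version a a g v M" using g[OF ID(1)] by blast
        have "?y a = (LINT \<tau>:{a..a}|lborel. frac_kernel \<alpha> a \<tau> * v \<tau>)"
          using left_frac_int_raw_version[OF v _ \<alpha>(1)] left_frac_int_raw_lborel[OF bounded_borel_versionD(1)[OF v] \<alpha>(1)] by simp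
        also have "\<dots> = 0"
          using abs_LINT_mult_le[OF bounded_borel_versionD(1,2)[OF v] frac_kernel_lborel(1)[OF \<alpha>(1), of a a a]]
            frac_kernel_lborel(2)[OF \<alpha>(1), of a a a] by (simp add: frac_kernel_nonneg \<alpha>)
        finally show ?thesis .
      qed
      ultimately show ?thesis using w(2) by simp
    qed
  qed
qed

text \<open>Membership in the Caputo space and the equation together say that \<open>h\<close>, the
  continuous representative of the integral of order 1 - \<alpha> of x - x(a), is locally absolutely
  continuous with derivative \<open>g\<close> almost everywhere.\<close>

lemma caputo_equation_iff:
  assumes I: "I \<in> intervals_from a" and g: "\<And>b. b \<in> I \<Longrightarrow> \<exists>v M. bounded_borel_version a b g v M"
    and \<alpha>: "0 < \<alpha>" "\<alpha> \<le> 1" and x: "continuous_on I x"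
  shows "x \<in> cAC_frac a I \<alpha> \<and> (AE t in lebesgue_on I. has_left_caputo_deriv a I \<alpha> x t (g t)) \<longleftrightarrow>
    (\<forall>t\<in>I. x t = x a + left_frac_int_raw a \<alpha> g t)"
proof -
  note ID = intervals_fromD[OF I]
  define w where "w s = x s - x a" for s
  have wc: "continuous_on I w" unfolding w_def using x by (intro continuous_intros)
  have w_version: "\<exists>v M. bounded_borel_version a b w v M" if "b \<in> I" for b
    using continuous_on_bounded_borel_version[OF continuous_on_subset[OF wc ID(4)[OF that]]] by blast
  define h where "h = left_frac_int a I (1 - \<alpha>) w"
  \<comment> \<open>Order 0 gives \<open>w\<close> itself, and positive orders give a continuous
    function by the Hoelder estimate; hence \<open>h\<close> equals the unmodified integral at every
    point of \<open>I\<close>.\<close>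
  have "continuous_on I (left_frac_int_raw a (1 - \<alpha>) w)"
  proof (cases "\<alpha> = 1")
    case True
    then show ?thesis using wc by (simp add: left_frac_int_raw_def[abs_def])
  next
    case False
    then show ?thesis using \<alpha> by (intro continuous_on_left_frac_int_raw_version[OF I w_version]) auto
  qed
  then have h: "h t = left_frac_int_raw a (1 - \<alpha>) w t" if "t \<in> I" for t
    using continuous_version_eq[OF I _ that] by (simp add: h_def left_frac_int_def)
  have "h a = 0"
  proof -
    have "h a = left_frac_int_raw a (1 - \<alpha>) (\<lambda>_. 0) a"
      unfolding h[OF ID(1)] by (intro left_frac_int_raw_cong) (auto simp: w_def)
    then show ?thesis by (simp add: left_frac_int_raw_def set_lebesgue_integral_def)
  qed
  have "w \<in> L1_loc I"
    using continuous_on_subset[OF wc] by (auto simp: L1_loc_def intro: continuous_imp_integrable_real)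
  then have "x \<in> cAC_frac a I \<alpha> \<and> (AE t in lebesgue_on I. has_left_caputo_deriv a I \<alpha> x t (g t)) \<longleftrightarrow>
      h \<in> AC_loc I \<and> (AE t in lebesgue_on I. (h has_real_derivative g t) (at t within I))"
    using x by (simp add: cAC_frac_def AC_frac_def has_left_caputo_deriv_def has_left_frac_deriv_def h_def w_def[abs_def])
  also have "\<dots> \<longleftrightarrow> (\<forall>t\<in>I. h t = left_frac_int_raw a 1 g t)"
    using AC_loc_iff_left_frac_int_raw_one[of I a g h] I g \<open>h a = 0\<close> by blast
  also have "\<dots> \<longleftrightarrow> (\<forall>t\<in>I. w t = left_frac_int_raw a \<alpha> g t)"
    using left_frac_int_raw_inverse_iff[OF I g \<alpha> wc] by (simp add: h w_def)
  finally show ?thesis by (simp add: w_def algebra_simps)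
qed

section \<open>The Cauchy problem\<close>

text \<open>Expansion in the standard basis turns integrable components into an integrable vector
  function; a coordinate is bounded linear and then commutes with the integral.\<close>

lemma integral_vec_nth:
  fixes F :: "'a \<Rightarrow> real ^ 'm"
  assumes "\<And>i. integrable M (\<lambda>x. F x $ i)"
  shows "integral\<^sup>L M F $ i = (LINT x|M. F x $ i)"
proof -
  have "integrable M (\<lambda>x. \<Sum>i\<in>UNIV. (F x $ i) *\<^sub>R axis i (1::real))"
    using assms by (intro Bochner_Integration.integrable_sum integrable_scaleR_left) auto
  also have "(\<lambda>x. \<Sum>i\<in>UNIV. (F x $ i) *\<^sub>R axis i (1::real)) = F"
    by (auto simp: fun_eq_iff vec_eq_iff axis_def if_distrib cong: if_cong)
  finally have "integrable M F" .
  from integral_bounded_linear[OF bounded_linear_vec_nth this] show ?thesis by simp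
qed

text \<open>The second equality of the conclusion identifies the continuous representative with the
  explicit integral at every \<open>t\<close>, and follows from the regularity of \<open>I\<close>
  and \<open>q\<close>. The equivalence itself is decided component by component.\<close>

theorem proposition7:
  fixes a :: real and I\<^sub>f :: "real set" and \<Omega> :: "(real ^ 'm) set"
    and f :: "real ^ 'm \<Rightarrow> real \<Rightarrow> real ^ 'm" and q\<^sub>a \<alpha> :: "real ^ 'm"
    and q :: "real \<Rightarrow> real ^ 'm" and I :: "real set"
  assumes "I\<^sub>f \<in> intervals_from a"
    and "open \<Omega>" and "\<Omega> \<noteq> {}"
    and "caratheodory \<Omega> I\<^sub>f f"
    and "q\<^sub>a \<in> \<Omega>"
    and "\<forall>i. 0 < \<alpha> $ i \<and> \<alpha> $ i \<le> 1"
    and "\<forall>K c d. compact K \<and> K \<subseteq> \<Omega> \<and> {c..d} \<subseteq> I\<^sub>f \<longrightarrow>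
           (\<exists>M\<ge>0. \<forall>x\<in>K. AE t in lebesgue_on {c..d}. norm (f x t) \<le> M)"
  shows "local_solution a I\<^sub>f \<Omega> f q\<^sub>a \<alpha> q I \<longleftrightarrow>
    I \<in> intervals_from a \<and> I \<subseteq> I\<^sub>f \<and> continuous_on I q \<and> q ` I \<subseteq> \<Omega> \<and>
    (\<forall>t\<in>I. q t = q\<^sub>a + left_frac_int_vec a I \<alpha> (\<lambda>\<tau>. f (q \<tau>) \<tau>) t \<and>
      q\<^sub>a + left_frac_int_vec a I \<alpha> (\<lambda>\<tau>. f (q \<tau>) \<tau>) t =
        q\<^sub>a + (LINT \<tau>:{a..t}|lebesgue. frac_kernel_vec \<alpha> t \<tau> * f (q \<tau>) \<tau>))"
proof (cases "I \<in> intervals_from a \<and> I \<subseteq> I\<^sub>f \<and> continuous_on I q \<and> q ` I \<subseteq> \<Omega>")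
  \<comment> \<open>Each side entails these regularity conditions, so both are false when they
    fail.\<close>
  case False
  have "continuous_on I q" if "q \<in> cAC_frac_vec a I \<alpha> \<Omega>"
    using that continuous_on_vec_lambda[of I "\<lambda>i s. q s $ i"] by (simp add: cAC_frac_vec_def cAC_frac_def)
  then show ?thesis using False by (auto simp: local_solution_def cAC_frac_vec_def)
next
  case True
  then have I: "I \<in> intervals_from a" and sub: "I \<subseteq> I\<^sub>f" and q: "continuous_on I q" "q ` I \<subseteq> \<Omega>" by auto
  note ID = intervals_fromD[OF I]
  have \<alpha>: "0 < \<alpha> $ i" "\<alpha> $ i \<le> 1" for i using assms(6) by auto
  let ?g = "\<lambda>t. f (q t) t"
  have g_meas: "?g \<in> borel_measurable (lebesgue_on I)"
    using borel_measurable_caratheodory_compose[OF assms(4) I sub _ q] intervals_fromD(2)[OF assms(1)] by simp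
  have version: "\<exists>v M. bounded_borel_version a b (\<lambda>t. ?g t $ i) v M" if b: "b \<in> I" for b i
  proof -
    have ab: "{a..b} \<subseteq> I" using ID(4)[OF b] .
    let ?K = "q ` {a..b}"
    have K: "compact ?K" "?K \<subseteq> \<Omega>"
      using ab q by (auto intro!: compact_continuous_image intro: continuous_on_subset)
    then obtain M where M: "\<And>x. x \<in> ?K \<Longrightarrow> AE t in lebesgue_on {a..b}. norm (f x t) \<le> M"
      using assms(7) ab sub by (meson order_trans)
    have "AE t in lebesgue_on I\<^sub>f. continuous_on \<Omega> (\<lambda>x. f x t)"
      using assms(4) by (simp add: caratheodory_def)
    then have "AE t in lebesgue. t \<in> I\<^sub>f \<longrightarrow> continuous_on \<Omega> (\<lambda>x. f x t)"
      using intervals_fromD(2)[OF assms(1)] by (subst (asm) AE_restrict_space_iff) auto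
    then have "AE t in lebesgue_on {a..b}. continuous_on ?K (\<lambda>x. f x t)"
      using K(2) ab sub by (subst AE_restrict_space_iff) (auto elim!: eventually_mono intro: continuous_on_subset)
    from AE_bounded_on[OF this M] have "AE t in lebesgue_on {a..b}. \<forall>x\<in>?K. norm (f x t) \<le> M" by simp
    moreover have "AE t in lebesgue_on {a..b}. t \<in> {a..b}" using AE_space[of "lebesgue_on {a..b}"] by simp
    ultimately have "AE t in lebesgue_on {a..b}. \<bar>?g t $ i\<bar> \<le> M"
      by eventually_elim (auto intro: order_trans[OF component_le_norm_cart])
    moreover have "(\<lambda>t. ?g t $ i) \<in> borel_measurable (lebesgue_on {a..b})"
      by (intro measurable_compose[OF measurable_restrict_mono[OF g_meas ab] borel_measurable_continuous_onI]
          continuous_on_component continuous_on_id)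
    ultimately show ?thesis by (intro ex_bounded_borel_version)
  qed
  have frac: "left_frac_int_vec a I \<alpha> ?g t $ i = left_frac_int_raw a (\<alpha> $ i) (\<lambda>s. ?g s $ i) t" if "t \<in> I" for t i
    using continuous_version_eq[OF I continuous_on_left_frac_int_raw_version[OF I _ \<alpha>] that] version
    by (simp add: left_frac_int_vec_def left_frac_int_def)
  have lint: "left_frac_int_vec a I \<alpha> ?g t = (LINT \<tau>:{a..t}|lebesgue. frac_kernel_vec \<alpha> t \<tau> * ?g \<tau>)" if t: "t \<in> I" for t
  proof -
    have "integrable lebesgue (\<lambda>\<tau>. (indicat_real {a..t} \<tau> *\<^sub>R (frac_kernel_vec \<alpha> t \<tau> * ?g \<tau>)) $ i)" for i
      using version[OF t, of i] integrable_frac_kernel_mult[OF _ order.refl ID(3)[OF t] \<alpha>(1)[of i]]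
      by (auto simp: frac_kernel_vec_def)
    from integral_vec_nth[OF this] show ?thesis
      using less_imp_neq[OF \<alpha>(1)]
      by (simp add: vec_eq_iff frac[OF t] left_frac_int_raw_def set_lebesgue_integral_def frac_kernel_vec_def)
  qed
  have sol: "(\<lambda>s. q s $ i) \<in> cAC_frac a I (\<alpha> $ i) \<and> (AE t in lebesgue_on I. has_left_caputo_deriv a I (\<alpha> $ i) (\<lambda>s. q s $ i) t (?g t $ i)) \<longleftrightarrow>
      (\<forall>t\<in>I. q t $ i = q a $ i + left_frac_int_raw a (\<alpha> $ i) (\<lambda>s. ?g s $ i) t)" for i
    using q(1) by (intro caputo_equation_iff[OF I version \<alpha>] continuous_intros)
  \<comment> \<open>There are finitely many components, so one null set serves for all of
    them.\<close>
  have "local_solution a I\<^sub>f \<Omega> f q\<^sub>a \<alpha> q I \<longleftrightarrow> q a = q\<^sub>a \<and>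
      (\<forall>i. (\<lambda>s. q s $ i) \<in> cAC_frac a I (\<alpha> $ i) \<and> (AE t in lebesgue_on I. has_left_caputo_deriv a I (\<alpha> $ i) (\<lambda>s. q s $ i) t (?g t $ i)))"
    using AE_ball_countable[where X = UNIV and M = "lebesgue_on I" and P = "\<lambda>t i. has_left_caputo_deriv a I (\<alpha> $ i) (\<lambda>s. q s $ i) t (?g t $ i)"] I sub q(2)
    by (auto simp: local_solution_def cAC_frac_vec_def has_left_caputo_deriv_vec_def)
  also have "\<dots> \<longleftrightarrow> q a = q\<^sub>a \<and> (\<forall>t\<in>I. q t = q a + left_frac_int_vec a I \<alpha> ?g t)"
    unfolding sol by (auto simp: vec_eq_iff frac)
  also have "\<dots> \<longleftrightarrow> (\<forall>t\<in>I. q t = q\<^sub>a + left_frac_int_vec a I \<alpha> ?g t)"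
  proof -
    \<comment> \<open>At t = a the integral runs over a single point, so the integral equation
      contains the initial condition.\<close>
    have "left_frac_int_vec a I \<alpha> ?g a = 0"
      unfolding lint[OF ID(1)] set_lebesgue_integral_def
      by (rule integral_eq_zero_AE, rule AE_mp[OF AE_completion[OF AE_lborel_singleton[of a]]]) auto
    then show ?thesis using ID(1) by auto
  qed
  finally show ?thesis using True lint by auto
qed

end
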